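(* Let $X=(x_0,x_1)$ be a bounded interval, let $\zeta\in\mathrm{Reg}_+(X)$, $\omega\in\mathbb{R}\setminus\Sigma_\zeta$ and $\xi\in\mathbb{D}$. Then the boundary value problem $$(\zeta u')'+\omega^2\zeta u=0\ \text{ on } X,\qquad u^{\rm r}(x_0+)=1,\qquad u^{\ell}(x_1-)=\xi\,u^{\rm r}(x_1-)$$ has a unique solution $u$ (in the sense that $u$ and $\zeta u'$ are absolutely continuous on $X$, the differential equation holds almost everywhere, and the boundary conditions hold).
   Context: $\mathbb{D}$ is the open unit disk in $\mathbb{C}$. $\mathrm{Step}(X)$ is the set of piecewise-constant complex-valued functions on $X$ with finitely many discontinuities; $\mathrm{Reg}(X)$ (regulated functions) is the closure of $\mathrm{Step}(X)$ in $L^\infty(X)$; equivalently, functions having one-sided limits at every point, including $x_0+$ and $x_1-$. $\mathrm{Reg}_+(X)=\{f\in\mathrm{Reg}(X): \exists\varepsilon>0,\ f(x)>\varepsilon\ \forall x\in X\}$. One-sided limits are written $f(x\pm)$. For $\omega\in\mathbb{R}\setminus\{0\}$ put $u^{\ell}=\frac12\bigl(u-\frac{1}{i\omega}u'\bigr)$ and $u^{\rm r}=\frac12\bigl(u+\frac{1}{i\omega}u'\bigr)$. An equivalent notion of solution of the differential equation is: $u\in W^{1,2}(X)$ and $(\zeta u')'+\omega^2\zeta u=0$ in the sense of distributions on $X$. The exceptional set $\Sigma_\zeta$: let $A_{\zeta,0}:L^2(X)\to L^2(X)$ be the compact operator that sends $\psi\in L^2(X)$ to the unique $A_{\zeta,0}\psi\in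 W^{1,2}(X)$ such that $\langle\zeta A_{\zeta,0}\psi,v\rangle_{L^2}+\langle\zeta (A_{\zeta,0}\psi)',v'\rangle_{L^2}=\langle\zeta\psi,v\rangle_{L^2}$ for all $v\in W^{1,2}(X)$. Then $\Sigma_\zeta=\{\pm\sqrt{\lambda^{-1}-1}:\lambda\in\operatorname{spec}A_{\zeta,0}\cap(0,1]\}$. This set is countable and contains $0$. *)

theory Defs
  imports "HOL-Analysis.Analysis"
begin

text \<open>
  Functions on an open interval \<open>X\<close> are total functions on the reals whose values off \<open>X\<close> are
  irrelevant; elements of \<open>L\<^sup>2(X)\<close> and \<open>L\<^sup>\<infinity>(X)\<close> are given by representatives, and equality there is
  equality almost everywhere on \<open>X\<close>.
\<close>

definition Step :: "real set \<Rightarrow> (real \<Rightarrow> complex) set" where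
  "Step X = {f. \<exists>P. finite P \<and> (\<forall>x\<in>X. \<forall>y\<in>X. x < y \<longrightarrow> {x..y} \<inter> P = {} \<longrightarrow> f x = f y)}"

definition Linf :: "real set \<Rightarrow> (real \<Rightarrow> complex) set" where
  "Linf X = {f. f \<in> borel_measurable (lebesgue_on X) \<and>
                (\<exists>C. AE x in lebesgue_on X. norm (f x) \<le> C)}"

definition Reg :: "real set \<Rightarrow> (real \<Rightarrow> complex) set" where
  "Reg X = {f \<in> Linf X. \<forall>\<epsilon>>0. \<exists>s\<in>Step X. AE x in lebesgue_on X. norm (f x - s x) \<le> \<epsilon>}"

definition Reg_plus :: "real set \<Rightarrow> (real \<Rightarrow> real) set" where
  "Reg_plus X = {f. (\<lambda>x. complex_of_real (f x)) \<in> Reg X \<and> (\<exists>\<epsilon>>0. \<forall>x\<in>X. f x > \<epsilon>)}"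

definition L2 :: "real set \<Rightarrow> (real \<Rightarrow> complex) set" where
  "L2 X = {f. f \<in> borel_measurable (lebesgue_on X) \<and>
              integrable (lebesgue_on X) (\<lambda>x. (norm (f x))\<^sup>2)}"

definition L2_inner :: "real set \<Rightarrow> (real \<Rightarrow> complex) \<Rightarrow> (real \<Rightarrow> complex) \<Rightarrow> complex" where
  "L2_inner X f g = (LINT x|lebesgue_on X. f x * cnj (g x))"

definition L2_norm :: "real set \<Rightarrow> (real \<Rightarrow> complex) \<Rightarrow> real" where
  "L2_norm X f = sqrt (LINT x|lebesgue_on X. (norm (f x))\<^sup>2)"

definition test_fun :: "real set \<Rightarrow> (real \<Rightarrow> real) \<Rightarrow> bool" where
  "test_fun X \<phi> \<longleftrightarrow> (\<forall>n x. (deriv ^^ n) \<phi> field_differentiable at x) \<and>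
                  (\<exists>K. compact K \<and> K \<subseteq> X \<and> (\<forall>x. x \<notin> K \<longrightarrow> \<phi> x = 0))"

text \<open>\<open>W12 X u u'\<close>: \<open>u\<close> belongs to \<open>W\<^sup>1\<^sup>,\<^sup>2(X)\<close> and its distributional derivative is \<open>u'\<close>.\<close>

definition W12 :: "real set \<Rightarrow> (real \<Rightarrow> complex) \<Rightarrow> (real \<Rightarrow> complex) \<Rightarrow> bool" where
  "W12 X u u' \<longleftrightarrow> u \<in> L2 X \<and> u' \<in> L2 X \<and>
     (\<forall>\<phi>. test_fun X \<phi> \<longrightarrow>
        (LINT x|lebesgue_on X. u x * of_real (deriv \<phi> x)) =
        - (LINT x|lebesgue_on X. u' x * of_real (\<phi> x)))"

text \<open>For \<open>\<psi> \<in> L2 X\<close> the function chosen here is unique up to a null set.\<close>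

definition A0 :: "real set \<Rightarrow> (real \<Rightarrow> real) \<Rightarrow> (real \<Rightarrow> complex) \<Rightarrow> (real \<Rightarrow> complex)" where
  "A0 X \<zeta> \<psi> = (SOME a. \<exists>a'. W12 X a a' \<and>
     (\<forall>v v'. W12 X v v' \<longrightarrow>
        L2_inner X (\<lambda>x. of_real (\<zeta> x) * a x) v + L2_inner X (\<lambda>x. of_real (\<zeta> x) * a' x) v' =
        L2_inner X (\<lambda>x. of_real (\<zeta> x) * \<psi> x) v))"

text \<open>
  \<open>z\<close> is in the resolvent set of \<open>T\<close> iff \<open>T - z\<close> is a bijection of \<open>L\<^sup>2(X)\<close> (modulo null functions)
  with bounded inverse.
\<close>

definition L2_resolvent_set ::
    "real set \<Rightarrow> ((real \<Rightarrow> complex) \<Rightarrow> (real \<Rightarrow> complex)) \<Rightarrow> complex set" where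
  "L2_resolvent_set X T = {z. \<exists>C. \<forall>f\<in>L2 X. \<exists>g\<in>L2 X.
      (AE x in lebesgue_on X. T g x - z * g x = f x) \<and>
      L2_norm X g \<le> C * L2_norm X f \<and>
      (\<forall>h\<in>L2 X. (AE x in lebesgue_on X. T h x - z * h x = f x) \<longrightarrow>
                 (AE x in lebesgue_on X. h x = g x))}"

definition L2_spec ::
    "real set \<Rightarrow> ((real \<Rightarrow> complex) \<Rightarrow> (real \<Rightarrow> complex)) \<Rightarrow> complex set" where
  "L2_spec X T = - L2_resolvent_set X T"

definition Sigma_exc :: "real set \<Rightarrow> (real \<Rightarrow> real) \<Rightarrow> real set" where
  "Sigma_exc X \<zeta> = {s. \<exists>l\<in>{0<..1}. complex_of_real l \<in> L2_spec X (A0 X \<zeta>) \<and>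
                        (s = sqrt (inverse l - 1) \<or> s = - sqrt (inverse l - 1))}"

definition AC_on :: "real set \<Rightarrow> (real \<Rightarrow> complex) \<Rightarrow> bool" where
  "AC_on X f \<longleftrightarrow> (\<forall>\<epsilon>>0. \<exists>\<delta>>0. \<forall>(n::nat) a b.
      (\<forall>i<n. a i \<le> b i \<and> {a i..b i} \<subseteq> X) \<longrightarrow>
      (\<forall>i<n. \<forall>j<n. i \<noteq> j \<longrightarrow> {a i<..<b i} \<inter> {a j<..<b j} = {}) \<longrightarrow>
      (\<Sum>i<n. b i - a i) < \<delta> \<longrightarrow>
      (\<Sum>i<n. norm (f (b i) - f (a i))) < \<epsilon>)"

definition u_left :: "real \<Rightarrow> (real \<Rightarrow> complex) \<Rightarrow> real \<Rightarrow> complex" where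
  "u_left \<omega> u x = (1/2) * (u x - 1 / (\<i> * of_real \<omega>) * vector_derivative u (at x))"

definition u_right :: "real \<Rightarrow> (real \<Rightarrow> complex) \<Rightarrow> real \<Rightarrow> complex" where
  "u_right \<omega> u x = (1/2) * (u x + 1 / (\<i> * of_real \<omega>) * vector_derivative u (at x))"

text \<open>
  The derivative of a solution exists only almost everywhere (it may fail to exist at the jumps of
  \<open>\<zeta>\<close>), so \<open>\<zeta> u'\<close> being absolutely continuous means agreeing almost everywhere with an absolutely
  continuous \<open>w\<close>, and the one-sided limits at the end points are taken along the (full measure) set
  of points of \<open>X\<close> where \<open>u\<close> is differentiable.
\<close>

definition ode_solution :: "real set \<Rightarrow> (real \<Rightarrow> real) \<Rightarrow> real \<Rightarrow> (real \<Rightarrow> complex) \<Rightarrow> bool" where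
  "ode_solution X \<zeta> \<omega> u \<longleftrightarrow> AC_on X u \<and>
     (\<exists>w. AC_on X w \<and>
        (AE x in lebesgue_on X. \<exists>d. (u has_vector_derivative d) (at x) \<and> w x = of_real (\<zeta> x) * d) \<and>
        (AE x in lebesgue_on X. \<exists>d. (w has_vector_derivative d) (at x) \<and>
                                    d + of_real (\<omega>\<^sup>2 * \<zeta> x) * u x = 0))"

definition limit_along_diff ::
    "real set \<Rightarrow> (real \<Rightarrow> complex) \<Rightarrow> (real \<Rightarrow> complex) \<Rightarrow> complex \<Rightarrow> real \<Rightarrow> bool" where
  "limit_along_diff X u f c p \<longleftrightarrow> (f \<longlongrightarrow> c) (at p within {x \<in> X. u differentiable (at x)})"

definition bvp_solution ::
    "real \<Rightarrow> real \<Rightarrow> (real \<Rightarrow> real) \<Rightarrow> real \<Rightarrow> complex \<Rightarrow> (real \<Rightarrow> complex) \<Rightarrow> bool" where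
  "bvp_solution x0 x1 \<zeta> \<omega> \<xi> u \<longleftrightarrow>
     ode_solution {x0<..<x1} \<zeta> \<omega> u \<and>
     limit_along_diff {x0<..<x1} u (u_right \<omega> u) 1 x0 \<and>
     (\<exists>l r. limit_along_diff {x0<..<x1} u (u_left \<omega> u) l x1 \<and>
            limit_along_diff {x0<..<x1} u (u_right \<omega> u) r x1 \<and>
            l = \<xi> * r)"

end

theory Submission
  imports Defs
begin

text \<open>
  With \<open>w = \<zeta> u'\<close>, the flux \<open>Im (cnj u * w) = \<omega> \<zeta> (\<bar>u\<^sup>r\<bar>\<^sup>2 - \<bar>u\<^sup>\<ell>\<bar>\<^sup>2)\<close> of a solution is constant. If
  \<open>u\<^sup>r(x\<^sub>0+) = 0\<close> and \<open>u\<^sup>\<ell>(x\<^sub>1-) = \<xi> u\<^sup>r(x\<^sub>1-)\<close> with \<open>\<bar>\<xi>\<bar> < 1\<close>, comparing the signs of the flux at the two end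
  points forces \<open>u\<close> and \<open>w\<close> to vanish at \<open>x\<^sub>1\<close>, hence everywhere by a Gronwall argument. This gives
  uniqueness. For existence, solve the terminal value problem with \<open>u\<^sup>r(x\<^sub>1-) = 1\<close>,
  \<open>u\<^sup>\<ell>(x\<^sub>1-) = \<xi>\<close>; by the same argument \<open>u\<^sup>r(x\<^sub>0+) \<noteq> 0\<close>, so the solution can be rescaled.
  Throughout \<open>\<omega> \<noteq> 0\<close>, because \<open>0\<close> is exceptional: \<open>A\<^sub>\<zeta>\<^sub>,\<^sub>0\<close> fixes the constants.
\<close>

section \<open>Absolutely continuous functions\<close>

text \<open>Two weaknesses of the data shape the argument. A solution \<open>u\<close> is
  differentiable only almost everywhere, with an exceptional set depending on \<open>u\<close>, and
  \<open>\<zeta>\<close> is controlled only up to null sets. In the uniqueness argument nothing is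
  therefore evaluated at an end point: boundary values are compared through the filter
  \<open>ess_at\<close>, common to all solutions, and flux and energy pass to the limit as
  inequalities in which \<open>\<zeta>\<close> is replaced by its bounds. Of the fundamental theorem
  for absolutely continuous functions only a monotonicity criterion, \<open>AC_on_Re_mono\<close>,
  is used; it is applied to imaginary multiples of \<open>cnj u * w\<close> and to an exponentially
  weighted energy. Regulatedness of \<open>\<zeta>\<close> does its work in the existence proof: the
  limits of \<open>\<zeta>\<close> at the end points translate wave amplitudes into values of
  \<open>(u, w)\<close> and back, and essential continuity almost everywhere allows the Picard
  integrals to be differentiated pointwise.\<close>

lemma AC_on_finite:
  assumes "AC_on X f" "e > 0"
  obtains d where "d > 0"
    "\<And>(I :: 'i set) a b. finite I \<Longrightarrow> (\<And>i. i \<in> I \<Longrightarrow> a i \<le> b i \<and> {a i..b i} \<subseteq> X) \<Longrightarrow>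
       (\<And>i j. i \<in> I \<Longrightarrow> j \<in> I \<Longrightarrow> i \<noteq> j \<Longrightarrow> {a i<..<b i} \<inter> {a j<..<b j} = {}) \<Longrightarrow>
       (\<Sum>i\<in>I. b i - a i) < d \<Longrightarrow> (\<Sum>i\<in>I. norm (f (b i) - f (a i))) < e"
proof -
  obtain d where d: "d > 0" "\<And>(n::nat) a b. (\<forall>i<n. a i \<le> b i \<and> {a i..b i} \<subseteq> X) \<Longrightarrow>
      (\<forall>i<n. \<forall>j<n. i \<noteq> j \<longrightarrow> {a i<..<b i} \<inter> {a j<..<b j} = {}) \<Longrightarrow>
      (\<Sum>i<n. b i - a i) < d \<Longrightarrow> (\<Sum>i<n. norm (f (b i) - f (a i))) < e"
    using assms(1)[unfolded AC_on_def, rule_format, OF assms(2)] by auto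
  show thesis
  proof (rule that[OF d(1)])
    fix I :: "'i set" and a b
    assume I: "finite I" "\<And>i. i \<in> I \<Longrightarrow> a i \<le> b i \<and> {a i..b i} \<subseteq> X"
       "\<And>i j. i \<in> I \<Longrightarrow> j \<in> I \<Longrightarrow> i \<noteq> j \<Longrightarrow> {a i<..<b i} \<inter> {a j<..<b j} = {}"
       "(\<Sum>i\<in>I. b i - a i) < d"
    obtain h where h: "bij_betw h {..<card I} I"
      using ex_bij_betw_nat_finite[OF I(1)] by (auto simp: atLeast0LessThan)
    have hI: "h i \<in> I" if "i < card I" for i
      using h that by (auto simp: bij_betw_def)
    have hinj: "h i \<noteq> h j" if "i < card I" "j < card I" "i \<noteq> j" for i j
      using h that by (auto simp: bij_betw_def inj_on_def)
    have "(\<Sum>i<card I. norm (f (b (h i)) - f (a (h i)))) < e"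
    proof (rule d(2))
      show "(\<Sum>i<card I. b (h i) - a (h i)) < d"
        using sum.reindex_bij_betw[OF h, of "\<lambda>i. b i - a i"] I(4) by simp
    qed (use I hI hinj in simp_all)
    then show "(\<Sum>i\<in>I. norm (f (b i) - f (a i))) < e"
      using sum.reindex_bij_betw[OF h, of "\<lambda>i. norm (f (b i) - f (a i))"] by simp
  qed
qed

text \<open>Used for the intervals of a tagged division whose tags lie in the null set: they stay
  inside its open cover \<open>T\<close>, so the measure of \<open>T\<close> bounds their total
  length.\<close>

lemma sum_length_disjoint_le:
  fixes a b :: "'i \<Rightarrow> real"
  assumes "finite I" "\<And>i. i \<in> I \<Longrightarrow> a i \<le> b i \<and> {a i..b i} \<subseteq> T"
    and "\<And>i j. i \<in> I \<Longrightarrow> j \<in> I \<Longrightarrow> i \<noteq> j \<Longrightarrow> {a i<..<b i} \<inter> {a j<..<b j} = {}"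
    and "T \<in> lmeasurable"
  shows "(\<Sum>i\<in>I. b i - a i) \<le> measure lebesgue T"
proof -
  have "(\<Sum>i\<in>I. b i - a i) = (\<Sum>i\<in>I. measure lebesgue {a i<..<b i})"
    using assms(2) by (intro sum.cong) auto
  also have "\<dots> = measure lebesgue (\<Union>i\<in>I. {a i<..<b i})"
  proof (rule measure_finite_Union[symmetric])
    show "emeasure lebesgue {a i<..<b i} \<noteq> \<infinity>" if "i \<in> I" for i
      using assms(2)[OF that] by simp
  qed (use assms(1,3) in \<open>auto simp: disjoint_family_on_def simp del: Int_greaterThanLessThan\<close>)
  also have "\<dots> \<le> measure lebesgue T"
  proof (rule measure_mono_fmeasurable)
    show "(\<Union>i\<in>I. {a i<..<b i}) \<subseteq> T"
    proof (rule UN_least)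
      fix i assume "i \<in> I"
      from assms(2)[OF this] show "{a i<..<b i} \<subseteq> T" by (auto simp: subset_eq)
    qed
    show "(\<Union>i\<in>I. {a i<..<b i}) \<in> sets lebesgue"
      using assms(1) by (intro sets.finite_UN) simp_all
  qed (rule assms(4))
  finally show ?thesis .
qed

lemma AE_lebesgue_on_null:
  assumes "AE x in lebesgue_on X. P x" "X \<in> sets lebesgue"
  obtains N where "N \<in> null_sets lebesgue" "\<And>x. x \<in> X \<Longrightarrow> x \<notin> N \<Longrightarrow> P x"
proof -
  have "AE x in lebesgue. x \<in> X \<longrightarrow> P x"
    using assms by (subst (asm) AE_restrict_space_iff) auto
  then obtain N where "N \<in> null_sets lebesgue" "{x \<in> space lebesgue. \<not> (x \<in> X \<longrightarrow> P x)} \<subseteq> N"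
    by (auto simp: eventually_ae_filter)
  then show ?thesis by (intro that) auto
qed

text \<open>
  The exceptional null set is covered by an open set so small that, by absolute continuity, the
  intervals of a fine tagged division with tags in it contribute at most \<open>e\<close>.
\<close>

lemma AC_on_Re_mono:
  assumes AC: "AC_on X f" and X: "X \<in> sets lebesgue" and ab: "a \<le> b" "{a..b} \<subseteq> X"
    and der: "AE x in lebesgue_on X. \<exists>d. (f has_vector_derivative d) (at x) \<and> 0 \<le> Re d"
  shows "Re (f a) \<le> Re (f b)"
proof -
  obtain N where N: "N \<in> null_sets lebesgue"
    "\<And>x. x \<in> X \<Longrightarrow> x \<notin> N \<Longrightarrow> \<exists>d. (f has_vector_derivative d) (at x) \<and> 0 \<le> Re d"
    using AE_lebesgue_on_null[OF der X] by blast
  \<comment> \<open>The part \<open>e * (b - a)\<close> comes from tags where \<open>f\<close> is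
    differentiable, the extra \<open>e\<close> from tags in the null set \<open>N\<close>.\<close>
  have main: "Re (f a) - Re (f b) \<le> e * (b - a + 1)" if e: "e > 0" for e
  proof -
    \<comment> \<open>The index type is that of the members of a tagged division, hence the passage
      from \<open>nat\<close> indices to arbitrary finite sets.\<close>
    obtain \<delta> where \<delta>: "\<delta> > 0"
      "\<And>(I :: (real \<times> real set) set) a b. finite I \<Longrightarrow> (\<And>i. i \<in> I \<Longrightarrow> a i \<le> b i \<and> {a i..b i} \<subseteq> X) \<Longrightarrow>
       (\<And>i j. i \<in> I \<Longrightarrow> j \<in> I \<Longrightarrow> i \<noteq> j \<Longrightarrow> {a i<..<b i} \<inter> {a j<..<b j} = {}) \<Longrightarrow>
       (\<Sum>i\<in>I. b i - a i) < \<delta> \<Longrightarrow> (\<Sum>i\<in>I. norm (f (b i) - f (a i))) < e"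
      by (rule AC_on_finite[OF AC e]) blast
    obtain T where T: "open T" "N \<subseteq> T" "T - N \<in> lmeasurable" "emeasure lebesgue (T - N) < ennreal \<delta>"
      using sets_lebesgue_outer_open[OF _ \<delta>(1), of N] N(1) by blast
    have TN: "T = (T - N) \<union> N"
      using T by auto
    have "N \<in> lmeasurable" using N(1) by (simp add: null_sets_def fmeasurable_def)
    then have Tl: "T \<in> lmeasurable"
      using T(3) TN by (metis fmeasurable.Un)
    have "emeasure lebesgue T = emeasure lebesgue (T - N)"
      using N(1) T(1) by (subst emeasure_Diff_null_set) auto
    then have "emeasure lebesgue T < ennreal \<delta>"
      using T by simp
    then have mT: "measure lebesgue T < \<delta>"
      using Tl \<delta>(1) by (simp add: emeasure_eq_measure2 ennreal_less_iff)
    \<comment> \<open>Straddle estimate: with \<open>y\<close> and \<open>z\<close> on opposite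
      sides of \<open>x\<close>, the linear part of the increment has the right sign because
      \<open>0 \<le> Re d\<close>, so only the two error terms of the derivative remain.\<close>
    have "\<exists>r>0. \<forall>y z. y \<le> x \<longrightarrow> x \<le> z \<longrightarrow> {y..z} \<subseteq> ball x r \<longrightarrow> Re (f y) - Re (f z) \<le> e * (z - y)"
      if x: "x \<in> X" "x \<notin> N" for x
    proof -
      obtain d where d: "(f has_vector_derivative d) (at x)" "0 \<le> Re d"
        using N(2) x by blast
      then obtain r where r: "r > 0"
        "\<And>y. norm (y - x) < r \<Longrightarrow> norm (f y - f x - (y - x) *\<^sub>R d) \<le> e * norm (y - x)"
        using e unfolding has_vector_derivative_def has_derivative_at_alt by meson
      show ?thesis
      proof (intro exI[of _ r] conjI allI impI)
        fix y z assume yz: "y \<le> x" "x \<le> z" "{y..z} \<subseteq> ball x r"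
        then have "y \<in> ball x r" "z \<in> ball x r" by (auto simp del: mem_ball)
        then have b: "norm (f y - f x - (y - x) *\<^sub>R d) \<le> e * (x - y)"
           "norm (f z - f x - (z - x) *\<^sub>R d) \<le> e * (z - x)"
          using r(2)[of y] r(2)[of z] yz(1,2)
          by (simp_all add: dist_real_def abs_of_nonpos abs_of_nonneg)
        have "Re (f y) - Re (f x) - (y - x) * Re d \<le> e * (x - y)"
          using abs_Re_le_cmod[of "f y - f x - (y - x) *\<^sub>R d"] b(1) by simp
        moreover have "- (Re (f z) - Re (f x) - (z - x) * Re d) \<le> e * (z - x)"
          using abs_Re_le_cmod[of "f z - f x - (z - x) *\<^sub>R d"] b(2) by simp
        moreover have "0 \<le> (z - x) * Re d" "(y - x) * Re d \<le> 0"
          using yz d(2) by (auto simp: mult_nonneg_nonneg mult_nonpos_nonneg)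
        ultimately show "Re (f y) - Re (f z) \<le> e * (z - y)"
          by (simp add: algebra_simps)
      qed (rule r(1))
    qed
    then obtain r where r: "\<And>x. x \<in> X \<Longrightarrow> x \<notin> N \<Longrightarrow> r x > 0"
      "\<And>x y z. x \<in> X \<Longrightarrow> x \<notin> N \<Longrightarrow> y \<le> x \<Longrightarrow> x \<le> z \<Longrightarrow> {y..z} \<subseteq> ball x (r x) \<Longrightarrow>
          Re (f y) - Re (f z) \<le> e * (z - y)"
      by metis
    \<comment> \<open>The last case merely makes \<open>\<gamma>\<close> a gauge on the whole line;
      every tag of the division lies in \<open>X\<close>.\<close>
    define \<gamma> where "\<gamma> x = (if x \<in> N then T else if x \<in> X then ball x (r x) else ball x 1)" for x
    have "gauge \<gamma>"
      using T r(1) by (auto simp: gauge_def \<gamma>_def)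
    then obtain p where p: "p tagged_division_of {a..b}" "\<gamma> fine p"
      using fine_division_exists_real by blast
    note pD = tagged_division_ofD[OF p(1)]
    have K: "Inf K \<le> x \<and> x \<le> Sup K \<and> K = {Inf K..Sup K} \<and> K \<subseteq> \<gamma> x \<and> K \<subseteq> X \<and> x \<in> X"
      if xK: "(x, K) \<in> p" for x K
    proof -
      obtain u v where uv: "K = {u..v}" using pD(4)[OF xK] by auto
      moreover have "x \<in> K" "K \<subseteq> {a..b}" using pD(2,3)[OF xK] by auto
      moreover have "K \<subseteq> \<gamma> x" using p(2) xK by (auto simp: fine_def)
      ultimately show ?thesis using ab by auto
    qed
    have disj: "{Inf K<..<Sup K} \<inter> {Inf L<..<Sup L} = {}"
      if "(x, K) \<in> p" "(y, L) \<in> p" "(x, K) \<noteq> (y, L)" for x y K L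
    proof -
      have "interior {Inf K..Sup K} \<inter> interior {Inf L..Sup L} = {}"
        using pD(5)[OF that] K[OF that(1)] K[OF that(2)] by simp
      then show ?thesis unfolding interior_atLeastAtMost_real .
    qed
    let ?N = "{q \<in> p. fst q \<in> N}" and ?G = "{q \<in> p. fst q \<notin> N}"
    have pU: "p = ?N \<union> ?G" by auto
    have len: "(\<Sum>q\<in>?N. Sup (snd q) - Inf (snd q)) \<le> measure lebesgue T"
    proof (rule sum_length_disjoint_le)
      show "finite ?N" using pD(1) by auto
      show "Inf (snd q) \<le> Sup (snd q) \<and> {Inf (snd q)..Sup (snd q)} \<subseteq> T" if "q \<in> ?N" for q
        using K[of "fst q" "snd q"] that by (auto simp: \<gamma>_def)
      show "{Inf (snd q)<..<Sup (snd q)} \<inter> {Inf (snd q')<..<Sup (snd q')} = {}"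
        if "q \<in> ?N" "q' \<in> ?N" "q \<noteq> q'" for q q'
        using disj[of "fst q" "snd q" "fst q'" "snd q'"] that
        by (simp add: prod_eq_iff del: Int_greaterThanLessThan)
    qed (rule Tl)
    have "(\<Sum>q\<in>?N. norm (f (Sup (snd q)) - f (Inf (snd q)))) < e"
    proof (rule \<delta>(2))
      show "finite ?N" using pD(1) by auto
      show "Inf (snd q) \<le> Sup (snd q) \<and> {Inf (snd q)..Sup (snd q)} \<subseteq> X" if "q \<in> ?N" for q
        using K[of "fst q" "snd q"] that by auto
      show "{Inf (snd q)<..<Sup (snd q)} \<inter> {Inf (snd q')<..<Sup (snd q')} = {}"
        if "q \<in> ?N" "q' \<in> ?N" "q \<noteq> q'" for q q'
        using disj[of "fst q" "snd q" "fst q'" "snd q'"] that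
        by (simp add: prod_eq_iff del: Int_greaterThanLessThan)
      show "(\<Sum>q\<in>?N. Sup (snd q) - Inf (snd q)) < \<delta>" using len mT by simp
    qed
    moreover have "(\<Sum>q\<in>?N. Re (f (Inf (snd q))) - Re (f (Sup (snd q))))
        \<le> (\<Sum>q\<in>?N. norm (f (Sup (snd q)) - f (Inf (snd q))))"
    proof (rule sum_mono)
      fix q
      show "Re (f (Inf (snd q))) - Re (f (Sup (snd q))) \<le> norm (f (Sup (snd q)) - f (Inf (snd q)))"
        using complex_Re_le_cmod[of "f (Inf (snd q)) - f (Sup (snd q))"] by (simp add: norm_minus_commute)
    qed
    ultimately have 1: "(\<Sum>q\<in>?N. Re (f (Inf (snd q))) - Re (f (Sup (snd q)))) \<le> e" by simp
    have "(\<Sum>q\<in>?G. Re (f (Inf (snd q))) - Re (f (Sup (snd q))))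
        \<le> (\<Sum>q\<in>?G. e * (Sup (snd q) - Inf (snd q)))"
    proof (rule sum_mono)
      fix q assume q: "q \<in> ?G"
      then show "Re (f (Inf (snd q))) - Re (f (Sup (snd q))) \<le> e * (Sup (snd q) - Inf (snd q))"
        using K[of "fst q" "snd q"] r(2)[of "fst q" "Inf (snd q)" "Sup (snd q)"]
        by (auto simp: \<gamma>_def)
    qed
    also have "\<dots> \<le> (\<Sum>q\<in>p. e * (Sup (snd q) - Inf (snd q)))"
    proof (rule sum_mono2)
      show "0 \<le> e * (Sup (snd q) - Inf (snd q))" if "q \<in> p - ?G" for q
        using K[of "fst q" "snd q"] that e by simp
    qed (use pD(1) in auto)
    also have "\<dots> = e * (b - a)"
      using additive_tagged_division_1[OF ab(1) p(1), of "\<lambda>x. x"]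
      by (simp add: sum_distrib_left[symmetric] case_prod_unfold)
    finally have 2: "(\<Sum>q\<in>?G. Re (f (Inf (snd q))) - Re (f (Sup (snd q)))) \<le> e * (b - a)" .
    have "Re (f a) - Re (f b) = (\<Sum>q\<in>p. Re (f (Inf (snd q))) - Re (f (Sup (snd q))))"
      using additive_tagged_division_1[OF ab(1) p(1), of "\<lambda>x. - Re (f x)"]
      by (simp add: case_prod_unfold)
    also have "\<dots> = (\<Sum>q\<in>?N. Re (f (Inf (snd q))) - Re (f (Sup (snd q))))
        + (\<Sum>q\<in>?G. Re (f (Inf (snd q))) - Re (f (Sup (snd q))))"
      by (subst pU, rule sum.union_disjoint) (use pD(1) in auto)
    finally show ?thesis using 1 2 by (simp add: algebra_simps)
  qed
  have "Re (f a) - Re (f b) \<le> 0 + \<epsilon>" if "\<epsilon> > 0" for \<epsilon>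
    using main[of "\<epsilon> / (b - a + 1)"] that ab by simp
  then have "Re (f a) - Re (f b) \<le> 0" by (rule field_le_epsilon)
  then show ?thesis by simp
qed

section \<open>Restriction and closure properties of absolute continuity\<close>

lemma AE_lebesgue_on_subset:
  assumes "AE x in lebesgue_on X. P x" "Y \<subseteq> X" "X \<in> sets lebesgue" "Y \<in> sets lebesgue"
  shows "AE x in lebesgue_on Y. P x"
proof -
  have "AE x in lebesgue. x \<in> X \<longrightarrow> P x"
    using assms(1,3) by (subst (asm) AE_restrict_space_iff) auto
  then have "AE x in lebesgue. x \<in> Y \<longrightarrow> P x"
    by eventually_elim (use assms(2) in auto)
  then show ?thesis
    using assms(4) by (subst AE_restrict_space_iff) auto
qed

lemma AC_on_subset: "AC_on X f \<Longrightarrow> Y \<subseteq> X \<Longrightarrow> AC_on Y f"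
  unfolding AC_on_def by (elim all_forward imp_forward ex_forward conj_forward) (auto 4 3)

text \<open>Common source of the closure properties below: each operation has increments bounded by
  a multiple of the increments of its arguments.\<close>

lemma AC_on_dominated:
  assumes "AC_on X f" "AC_on X g" "0 \<le> L"
    and "\<And>x y. x \<in> X \<Longrightarrow> y \<in> X \<Longrightarrow> norm (h x - h y) \<le> L * (norm (f x - f y) + norm (g x - g y))"
  shows "AC_on X h"
  unfolding AC_on_def
proof (intro allI impI)
  fix e :: real assume "e > 0"
  \<comment> \<open>With \<open>L + 1\<close> in place of \<open>L\<close> the case
    \<open>L = 0\<close> is covered, and the final factor \<open>L / (L + 1)\<close> is strictly
    below 1.\<close>
  then have "e / (2 * (L + 1)) > 0" using assms(3) by simp
  then obtain d1 d2 where d1: "d1 > 0" "\<And>(n::nat) a b. \<forall>i<n. a i \<le> b i \<and> {a i..b i} \<subseteq> X \<Longrightarrow>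
      \<forall>i<n. \<forall>j<n. i \<noteq> j \<longrightarrow> {a i<..<b i} \<inter> {a j<..<b j} = {} \<Longrightarrow> (\<Sum>i<n. b i - a i) < d1 \<Longrightarrow>
      (\<Sum>i<n. norm (f (b i) - f (a i))) < e / (2 * (L + 1))"
    and d2: "d2 > 0" "\<And>(n::nat) a b. \<forall>i<n. a i \<le> b i \<and> {a i..b i} \<subseteq> X \<Longrightarrow>
      \<forall>i<n. \<forall>j<n. i \<noteq> j \<longrightarrow> {a i<..<b i} \<inter> {a j<..<b j} = {} \<Longrightarrow> (\<Sum>i<n. b i - a i) < d2 \<Longrightarrow>
      (\<Sum>i<n. norm (g (b i) - g (a i))) < e / (2 * (L + 1))"
    using assms(1,2)[unfolded AC_on_def, rule_format, of "e / (2 * (L + 1))"] by auto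
  show "\<exists>d>0. \<forall>(n::nat) a b. (\<forall>i<n. a i \<le> b i \<and> {a i..b i} \<subseteq> X) \<longrightarrow>
      (\<forall>i<n. \<forall>j<n. i \<noteq> j \<longrightarrow> {a i<..<b i} \<inter> {a j<..<b j} = {}) \<longrightarrow>
      (\<Sum>i<n. b i - a i) < d \<longrightarrow> (\<Sum>i<n. norm (h (b i) - h (a i))) < e"
  proof (intro exI[of _ "min d1 d2"] conjI allI impI)
    fix n :: nat and a b
    assume *: "\<forall>i<n. a i \<le> b i \<and> {a i..b i} \<subseteq> X"
      "\<forall>i<n. \<forall>j<n. i \<noteq> j \<longrightarrow> {a i<..<b i} \<inter> {a j<..<b j} = {}" "(\<Sum>i<n. b i - a i) < min d1 d2"
    have X: "a i \<in> X" "b i \<in> X" if "i < n" for i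
      using *(1) that by (auto simp: subset_eq)
    have "(\<Sum>i<n. norm (h (b i) - h (a i))) \<le> (\<Sum>i<n. L * (norm (f (b i) - f (a i)) + norm (g (b i) - g (a i))))"
      using assms(4) X by (intro sum_mono) simp
    also have "\<dots> = L * ((\<Sum>i<n. norm (f (b i) - f (a i))) + (\<Sum>i<n. norm (g (b i) - g (a i))))"
      unfolding sum.distrib[symmetric] sum_distrib_left ..
    also have "\<dots> \<le> L * (e / (2 * (L + 1)) + e / (2 * (L + 1)))"
      using d1(2)[OF *(1,2)] d2(2)[OF *(1,2)] *(3) assms(3)
      by (intro mult_left_mono add_mono) auto
    also have "\<dots> = e * (L / (L + 1))"
    proof -
      have "e / (2 * (L + 1)) + e / (2 * (L + 1)) = e / (L + 1)"
        by (simp only: divide_divide_eq_left[symmetric] add_divide_distrib[symmetric]) simp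
      then show ?thesis by simp
    qed
    also have "\<dots> < e * 1" using \<open>e > 0\<close> assms(3) by (intro mult_strict_left_mono) auto
    finally show "(\<Sum>i<n. norm (h (b i) - h (a i))) < e" by simp
  qed (use d1(1) d2(1) in auto)
qed

lemma AC_on_Lipschitz:
  assumes "\<And>x y. x \<in> X \<Longrightarrow> y \<in> X \<Longrightarrow> norm (f x - f y) \<le> L * \<bar>x - y\<bar>" "0 \<le> L"
  shows "AC_on X f"
  unfolding AC_on_def
proof (intro allI impI)
  fix e :: real assume e: "e > 0"
  show "\<exists>d>0. \<forall>(n::nat) a b. (\<forall>i<n. a i \<le> b i \<and> {a i..b i} \<subseteq> X) \<longrightarrow>
      (\<forall>i<n. \<forall>j<n. i \<noteq> j \<longrightarrow> {a i<..<b i} \<inter> {a j<..<b j} = {}) \<longrightarrow>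
      (\<Sum>i<n. b i - a i) < d \<longrightarrow> (\<Sum>i<n. norm (f (b i) - f (a i))) < e"
  proof (intro exI[of _ "e / (L + 1)"] conjI allI impI)
    fix n :: nat and a b
    assume *: "\<forall>i<n. a i \<le> b i \<and> {a i..b i} \<subseteq> X" "(\<Sum>i<n. b i - a i) < e / (L + 1)"
    have "(\<Sum>i<n. norm (f (b i) - f (a i))) \<le> (\<Sum>i<n. L * (b i - a i))"
    proof (rule sum_mono)
      fix i assume "i \<in> {..<n}"
      then have "a i \<le> b i" "a i \<in> X" "b i \<in> X" using *(1) by (auto simp: subset_eq)
      then show "norm (f (b i) - f (a i)) \<le> L * (b i - a i)" using assms(1)[of "b i" "a i"] by simp
    qed
    also have "\<dots> = L * (\<Sum>i<n. b i - a i)" by (simp add: sum_distrib_left)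
    also have "\<dots> \<le> L * (e / (L + 1))" using *(2) assms(2) by (intro mult_left_mono) auto
    also have "\<dots> = e * (L / (L + 1))" by simp
    also have "\<dots> < e * 1" using e assms(2) by (intro mult_strict_left_mono) auto
    finally show "(\<Sum>i<n. norm (f (b i) - f (a i))) < e" by simp
  qed (use e assms in auto)
qed

lemma AC_on_imp_continuous_on:
  assumes "AC_on {a..b} f" shows "continuous_on {a..b} f"
  unfolding continuous_on_iff
proof (intro ballI allI impI)
  fix x e :: real assume x: "x \<in> {a..b}" and e: "e > 0"
  obtain d where d: "d > 0" "\<And>(n::nat) p q. \<forall>i<n. p i \<le> q i \<and> {p i..q i} \<subseteq> {a..b} \<Longrightarrow>
      \<forall>i<n. \<forall>j<n. i \<noteq> j \<longrightarrow> {p i<..<q i} \<inter> {p j<..<q j} = {} \<Longrightarrow> (\<Sum>i<n. q i - p i) < d \<Longrightarrow>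
      (\<Sum>i<n. norm (f (q i) - f (p i))) < e"
    using assms[unfolded AC_on_def, rule_format, OF e] by auto
  show "\<exists>d>0. \<forall>y\<in>{a..b}. dist y x < d \<longrightarrow> dist (f y) (f x) < e"
  proof (intro exI[of _ d] conjI ballI impI)
    fix y assume y: "y \<in> {a..b}" "dist y x < d"
    have "norm (f (max x y) - f (min x y)) < e"
      using d(2)[of 1 "\<lambda>_. min x y" "\<lambda>_. max x y"] x y by (auto simp: dist_real_def)
    then show "dist (f y) (f x) < e"
      by (auto simp: dist_norm max_def min_def norm_minus_commute split: if_splits)
  qed (rule d(1))
qed

lemma AC_on_bounded:
  assumes "AC_on {a..b} f"
  obtains B where "B > 0" "\<And>x. x \<in> {a..b} \<Longrightarrow> norm (f x) \<le> B"
proof -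
  have "bounded (f ` {a..b})"
    using AC_on_imp_continuous_on[OF assms] by (intro compact_imp_bounded compact_continuous_image) auto
  then show ?thesis using that by (auto simp: bounded_pos)
qed

text \<open>The product rule for increments needs bounded factors. Compactness of
  \<open>{a..b}\<close> supplies the bounds, which is why flux and energy are studied on closed
  subintervals of \<open>X\<close>.\<close>

lemma AC_on_mult:
  assumes f: "AC_on {a..b} f" and g: "AC_on {a..b} g"
  shows "AC_on {a..b} (\<lambda>x. f x * g x)"
proof -
  obtain B C where B: "B > 0" "\<And>x. x \<in> {a..b} \<Longrightarrow> norm (f x) \<le> B"
    and C: "C > 0" "\<And>x. x \<in> {a..b} \<Longrightarrow> norm (g x) \<le> C"
    using AC_on_bounded[OF f] AC_on_bounded[OF g] by metis
  show ?thesis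
  proof (rule AC_on_dominated[OF f g, of "B + C"])
    fix x y assume x: "x \<in> {a..b}" "y \<in> {a..b}"
    have "f x * g x - f y * g y = f x * (g x - g y) + g y * (f x - f y)" by (simp add: algebra_simps)
    then have "norm (f x * g x - f y * g y) \<le> norm (f x) * norm (g x - g y) + norm (g y) * norm (f x - f y)"
      by (metis norm_mult norm_triangle_ineq)
    also have "\<dots> \<le> (B + C) * norm (g x - g y) + (B + C) * norm (f x - f y)"
      using B(1) C(1) B(2)[OF x(1)] C(2)[OF x(2)] by (intro add_mono mult_right_mono) auto
    finally show "norm (f x * g x - f y * g y) \<le> (B + C) * (norm (f x - f y) + norm (g x - g y))"
      by (simp add: algebra_simps)
  qed (use B C in auto)
qed

lemma AC_on_add: "AC_on X f \<Longrightarrow> AC_on X g \<Longrightarrow> AC_on X (\<lambda>x. f x + g x)"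
  by (rule AC_on_dominated[of X f g 1]) (auto simp: add_diff_add intro: norm_triangle_ineq)

lemma AC_on_diff: "AC_on X f \<Longrightarrow> AC_on X g \<Longrightarrow> AC_on X (\<lambda>x. f x - g x)"
proof (rule AC_on_dominated[of X f g 1])
  fix x y
  have "f x - g x - (f y - g y) = (f x - f y) - (g x - g y)" by simp
  then show "norm (f x - g x - (f y - g y)) \<le> 1 * (norm (f x - f y) + norm (g x - g y))"
    by (metis mult_1 norm_triangle_ineq4)
qed auto

lemma AC_on_cmult: "AC_on X f \<Longrightarrow> AC_on X (\<lambda>x. c * f x)"
  by (rule AC_on_dominated[of X f f "norm c"])
     (auto simp: right_diff_distrib[symmetric] norm_mult mult_left_mono)

lemma AC_on_cnj: "AC_on X f \<Longrightarrow> AC_on X (\<lambda>x. cnj (f x))"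
  by (rule AC_on_dominated[of X f f 1]) (auto simp: complex_cnj_diff[symmetric] simp del: complex_cnj_diff)

text \<open>Provides the integrating factor of the energy estimate; the Lipschitz constant bounds
  the derivative on \<open>{a..b}\<close>.\<close>

lemma AC_on_exp: "AC_on {a..b} (\<lambda>x. complex_of_real (exp (K * x)))"
proof (rule AC_on_Lipschitz[where L = "\<bar>K\<bar> * exp (\<bar>K\<bar> * max \<bar>a\<bar> \<bar>b\<bar>)"])
  fix x y assume x: "x \<in> {a..b}" "y \<in> {a..b}"
  have "norm (exp (K * x) - exp (K * y)) \<le> \<bar>K\<bar> * exp (\<bar>K\<bar> * max \<bar>a\<bar> \<bar>b\<bar>) * norm (x - y)"
  proof (rule field_differentiable_bound[of "{a..b}" "\<lambda>x. exp (K * x)" "\<lambda>x. K * exp (K * x)"])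
    fix z assume z: "z \<in> {a..b}"
    show "((\<lambda>x. exp (K * x)) has_field_derivative K * exp (K * z)) (at z within {a..b})"
      by (auto intro!: derivative_eq_intros)
    have "K * z \<le> \<bar>K\<bar> * \<bar>z\<bar>" by (metis abs_ge_self abs_mult)
    also have "\<dots> \<le> \<bar>K\<bar> * max \<bar>a\<bar> \<bar>b\<bar>" using z by (intro mult_left_mono) auto
    finally show "norm (K * exp (K * z)) \<le> \<bar>K\<bar> * exp (\<bar>K\<bar> * max \<bar>a\<bar> \<bar>b\<bar>)"
      by (simp add: abs_mult mult_left_mono)
  qed (use x in auto)
  then show "norm (complex_of_real (exp (K * x)) - complex_of_real (exp (K * y)))
      \<le> \<bar>K\<bar> * exp (\<bar>K\<bar> * max \<bar>a\<bar> \<bar>b\<bar>) * \<bar>x - y\<bar>"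
    by (metis norm_of_real of_real_diff real_norm_def)
qed auto

section \<open>Flux and energy of solutions\<close>

text \<open>Exposes the flux variable \<open>w\<close> that \<open>ode_solution\<close> hides behind
  a quantifier. Unlike \<open>\<zeta> u'\<close>, it has a meaningful value at every point of
  \<open>X\<close>.\<close>

definition solution_pair ::
    "real set \<Rightarrow> (real \<Rightarrow> real) \<Rightarrow> real \<Rightarrow> (real \<Rightarrow> complex) \<Rightarrow> (real \<Rightarrow> complex) \<Rightarrow> bool" where
  "solution_pair X \<zeta> \<omega> u w \<longleftrightarrow> AC_on X u \<and> AC_on X w \<and>
     (AE x in lebesgue_on X. \<exists>d. (u has_vector_derivative d) (at x) \<and> w x = of_real (\<zeta> x) * d) \<and>
     (AE x in lebesgue_on X. \<exists>d. (w has_vector_derivative d) (at x) \<and>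
                                    d + of_real (\<omega>\<^sup>2 * \<zeta> x) * u x = 0)"

lemma ode_solution_iff: "ode_solution X \<zeta> \<omega> u \<longleftrightarrow> (\<exists>w. solution_pair X \<zeta> \<omega> u w)"
  by (auto simp: ode_solution_def solution_pair_def)

lemma solution_pair_subset:
  assumes "solution_pair X \<zeta> \<omega> u w" "Y \<subseteq> X" "X \<in> sets lebesgue" "Y \<in> sets lebesgue"
  shows "solution_pair Y \<zeta> \<omega> u w"
  using assms unfolding solution_pair_def
  by (auto intro: AC_on_subset AE_lebesgue_on_subset[where X = X])

lemma solution_pair_diff:
  assumes "solution_pair X \<zeta> \<omega> u w" "solution_pair X \<zeta> \<omega> v z"
  shows "solution_pair X \<zeta> \<omega> (\<lambda>x. u x - v x) (\<lambda>x. w x - z x)"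
  unfolding solution_pair_def
proof (intro conjI)
  note a = assms[unfolded solution_pair_def]
  show "AC_on X (\<lambda>x. u x - v x)" "AC_on X (\<lambda>x. w x - z x)"
    using a by (auto intro: AC_on_diff)
  have "AE x in lebesgue_on X. \<exists>d. (u has_vector_derivative d) (at x) \<and> w x = of_real (\<zeta> x) * d"
    "AE x in lebesgue_on X. \<exists>d. (v has_vector_derivative d) (at x) \<and> z x = of_real (\<zeta> x) * d"
    using a by auto
  then show "AE x in lebesgue_on X. \<exists>d. ((\<lambda>x. u x - v x) has_vector_derivative d) (at x) \<and>
      w x - z x = of_real (\<zeta> x) * d"
    by eventually_elim (metis has_vector_derivative_diff right_diff_distrib)
  have "AE x in lebesgue_on X. \<exists>d. (w has_vector_derivative d) (at x) \<and> d + of_real (\<omega>\<^sup>2 * \<zeta> x) * u x = 0"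
    "AE x in lebesgue_on X. \<exists>d. (z has_vector_derivative d) (at x) \<and> d + of_real (\<omega>\<^sup>2 * \<zeta> x) * v x = 0"
    using a by auto
  then show "AE x in lebesgue_on X. \<exists>d. ((\<lambda>x. w x - z x) has_vector_derivative d) (at x) \<and>
      d + of_real (\<omega>\<^sup>2 * \<zeta> x) * (u x - v x) = 0"
  proof eventually_elim
    case (elim x)
    then obtain d e where de: "(w has_vector_derivative d) (at x)" "d + of_real (\<omega>\<^sup>2 * \<zeta> x) * u x = 0"
      "(z has_vector_derivative e) (at x)" "e + of_real (\<omega>\<^sup>2 * \<zeta> x) * v x = 0" by blast
    have "d - e + of_real (\<omega>\<^sup>2 * \<zeta> x) * (u x - v x)
        = (d + of_real (\<omega>\<^sup>2 * \<zeta> x) * u x) - (e + of_real (\<omega>\<^sup>2 * \<zeta> x) * v x)"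
      by (simp add: algebra_simps)
    then have "d - e + of_real (\<omega>\<^sup>2 * \<zeta> x) * (u x - v x) = 0"
      unfolding de by simp
    with de show ?case
      by (intro exI[of _ "d - e"] conjI has_vector_derivative_diff)
  qed
qed

lemma solution_pair_cmult:
  assumes "solution_pair X \<zeta> \<omega> u w"
  shows "solution_pair X \<zeta> \<omega> (\<lambda>x. c * u x) (\<lambda>x. c * w x)"
  unfolding solution_pair_def
proof (intro conjI)
  note a = assms[unfolded solution_pair_def]
  show "AC_on X (\<lambda>x. c * u x)" "AC_on X (\<lambda>x. c * w x)"
    using a by (auto intro: AC_on_cmult)
  have "AE x in lebesgue_on X. \<exists>d. (u has_vector_derivative d) (at x) \<and> w x = of_real (\<zeta> x) * d"
    using a by auto
  then show "AE x in lebesgue_on X. \<exists>d. ((\<lambda>x. c * u x) has_vector_derivative d) (at x) \<and>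
      c * w x = of_real (\<zeta> x) * d"
    by eventually_elim (metis has_vector_derivative_mult_right mult.left_commute)
  have "AE x in lebesgue_on X. \<exists>d. (w has_vector_derivative d) (at x) \<and> d + of_real (\<omega>\<^sup>2 * \<zeta> x) * u x = 0"
    using a by auto
  then show "AE x in lebesgue_on X. \<exists>d. ((\<lambda>x. c * w x) has_vector_derivative d) (at x) \<and>
      d + of_real (\<omega>\<^sup>2 * \<zeta> x) * (c * u x) = 0"
  proof eventually_elim
    case (elim x)
    then obtain d where d: "(w has_vector_derivative d) (at x)" "d + of_real (\<omega>\<^sup>2 * \<zeta> x) * u x = 0"
      by blast
    have "c * d + of_real (\<omega>\<^sup>2 * \<zeta> x) * (c * u x) = c * (d + of_real (\<omega>\<^sup>2 * \<zeta> x) * u x)"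
      by (simp add: algebra_simps)
    then show ?case
      using d by (intro exI[of _ "c * d"]) (auto intro: has_vector_derivative_mult_right)
  qed
qed

text \<open>By the equation, \<open>cnj u * w\<close> has derivative \<open>\<zeta> * (norm
  u')\<^sup>2 - \<omega>\<^sup>2 * \<zeta> * (norm u)\<^sup>2\<close> almost everywhere, which is
  real since \<open>\<zeta>\<close> and \<open>\<omega>\<close> are.\<close>

lemma solution_pair_flux:
  assumes s: "solution_pair X \<zeta> \<omega> u w" and X: "X \<in> sets lebesgue" and ab: "a \<le> b" "{a..b} \<subseteq> X"
  shows "Im (cnj (u a) * w a) = Im (cnj (u b) * w b)"
proof -
  have s': "solution_pair {a..b} \<zeta> \<omega> u w"
    using solution_pair_subset[OF s ab(2) X] by simp
  \<comment> \<open>A purely imaginary \<open>c\<close> turns the real derivative into one with real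
    part 0. The choices \<open>\<i>\<close> and \<open>-\<i>\<close> then give the two opposite
    inequalities for the imaginary part.\<close>
  have mono: "Re (c * (cnj (u a) * w a)) \<le> Re (c * (cnj (u b) * w b))" if c: "Re c = 0" for c
  proof (rule AC_on_Re_mono[of "{a..b}" _ a b])
    show "AC_on {a..b} (\<lambda>x. c * (cnj (u x) * w x))"
      using s' by (auto simp: solution_pair_def intro!: AC_on_cmult AC_on_mult AC_on_cnj)
    have "AE x in lebesgue_on {a..b}. \<exists>d. (u has_vector_derivative d) (at x) \<and> w x = of_real (\<zeta> x) * d"
      "AE x in lebesgue_on {a..b}. \<exists>d. (w has_vector_derivative d) (at x) \<and> d + of_real (\<omega>\<^sup>2 * \<zeta> x) * u x = 0"
      using s' by (auto simp: solution_pair_def)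
    then show "AE x in lebesgue_on {a..b}.
        \<exists>d. ((\<lambda>x. c * (cnj (u x) * w x)) has_vector_derivative d) (at x) \<and> 0 \<le> Re d"
    proof eventually_elim
      case (elim x)
      then obtain d e where d: "(u has_vector_derivative d) (at x)" "w x = of_real (\<zeta> x) * d"
        and e: "(w has_vector_derivative e) (at x)" "e + of_real (\<omega>\<^sup>2 * \<zeta> x) * u x = 0"
        by blast
      have e': "e = - (of_real (\<omega>\<^sup>2 * \<zeta> x) * u x)" using e(2) by (simp add: eq_neg_iff_add_eq_0)
      have "((\<lambda>x. c * (cnj (u x) * w x)) has_vector_derivative c * (cnj (u x) * e + cnj d * w x)) (at x)"
        using d(1) e(1) by (intro has_vector_derivative_mult_right has_vector_derivative_mult has_vector_derivative_cnj)
      moreover have "cnj (u x) * e + cnj d * w x = of_real (\<zeta> x * (norm d)\<^sup>2 - \<omega>\<^sup>2 * \<zeta> x * (norm (u x))\<^sup>2)"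
        unfolding e' d(2) by (simp add: complex_norm_square algebra_simps del: of_real_power)
      ultimately show ?case using c by (intro exI conjI) auto
    qed
  qed (use ab in auto)
  show ?thesis using mono[of \<i>] mono[of "-\<i>"] by simp
qed

text \<open>Gronwall's inequality run backward: the energy at \<open>b\<close> controls the energy
  at earlier points. The derivative of the energy is \<open>2 * (inverse (\<zeta> x) -
  \<omega>\<^sup>2 * \<zeta> x) * Re (cnj (u x) * w x)\<close>. Here the bracket is at most
  \<open>K\<close> in modulus, and twice the real part is at most the energy, so the energy
  decreases at a rate no larger than \<open>K\<close>, which the weight \<open>exp (K * x)\<close>
  compensates.\<close>

lemma solution_pair_energy:
  assumes s: "solution_pair X \<zeta> \<omega> u w" and X: "X \<in> sets lebesgue" and ab: "a \<le> b" "{a..b} \<subseteq> X"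
    and \<zeta>: "m > 0" "AE x in lebesgue_on X. m \<le> \<zeta> x \<and> \<zeta> x \<le> M"
  defines "K \<equiv> inverse m + \<omega>\<^sup>2 * M"
  shows "exp (K * a) * ((norm (u a))\<^sup>2 + (norm (w a))\<^sup>2) \<le> exp (K * b) * ((norm (u b))\<^sup>2 + (norm (w b))\<^sup>2)"
proof -
  let ?f = "\<lambda>x. of_real (exp (K * x)) * (cnj (u x) * u x + cnj (w x) * w x)"
  have s': "solution_pair {a..b} \<zeta> \<omega> u w"
    using solution_pair_subset[OF s ab(2) X] by simp
  have "Re (?f a) \<le> Re (?f b)"
  proof (rule AC_on_Re_mono[of "{a..b}" _ a b])
    show "AC_on {a..b} ?f"
      using s' by (auto simp: solution_pair_def intro!: AC_on_exp AC_on_mult AC_on_cnj AC_on_add)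
    have "AE x in lebesgue_on {a..b}. \<exists>d. (u has_vector_derivative d) (at x) \<and> w x = of_real (\<zeta> x) * d"
      "AE x in lebesgue_on {a..b}. \<exists>d. (w has_vector_derivative d) (at x) \<and> d + of_real (\<omega>\<^sup>2 * \<zeta> x) * u x = 0"
      using s' by (auto simp: solution_pair_def)
    moreover have "AE x in lebesgue_on {a..b}. m \<le> \<zeta> x \<and> \<zeta> x \<le> M"
      using AE_lebesgue_on_subset[OF \<zeta>(2) ab(2) X] by simp
    ultimately show "AE x in lebesgue_on {a..b}. \<exists>d. (?f has_vector_derivative d) (at x) \<and> 0 \<le> Re d"
    proof eventually_elim
      case (elim x)
      then obtain d e where d: "(u has_vector_derivative d) (at x)" "w x = of_real (\<zeta> x) * d"
        and e: "(w has_vector_derivative e) (at x)" "e + of_real (\<omega>\<^sup>2 * \<zeta> x) * u x = 0"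
        and z: "m \<le> \<zeta> x" "\<zeta> x \<le> M"
        by blast
      have z0: "\<zeta> x > 0" using z \<zeta>(1) by simp
      have e': "e = - (of_real (\<omega>\<^sup>2 * \<zeta> x) * u x)" using e(2) by (simp add: eq_neg_iff_add_eq_0)
      have d': "d = of_real (inverse (\<zeta> x)) * w x" using d(2) z0 by (simp add: field_simps)
      let ?E = "cnj (u x) * u x + cnj (w x) * w x"
      let ?D = "of_real (exp (K * x)) * ((cnj (u x) * d + cnj d * u x) + (cnj (w x) * e + cnj e * w x))
          + of_real (K * exp (K * x)) * ?E"
      have "((\<lambda>x. exp (K * x)) has_field_derivative K * exp (K * x)) (at x)"
        by (auto intro!: derivative_eq_intros)
      then have "((\<lambda>x. complex_of_real (exp (K * x))) has_vector_derivative of_real (K * exp (K * x))) (at x)"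
        by (intro has_vector_derivative_of_real)
      then have "(?f has_vector_derivative ?D) (at x)"
        using d(1) e(1)
        by (intro has_vector_derivative_mult has_vector_derivative_add has_vector_derivative_cnj)
      moreover have "0 \<le> Re ?D"
      proof -
        have aux: "0 \<le> p + K * t" if "p = r" "\<bar>r\<bar> \<le> K * q" "t = q" for p q r t :: real
          using that by (simp add: abs_le_iff)
        have "Re ((cnj (u x) * d + cnj d * u x) + (cnj (w x) * e + cnj e * w x))
            = 2 * (inverse (\<zeta> x) - \<omega>\<^sup>2 * \<zeta> x) * Re (cnj (u x) * w x)"
          unfolding d' e' of_real_inverse[symmetric] by (simp add: algebra_simps del: of_real_inverse)
        moreover have "\<bar>2 * (inverse (\<zeta> x) - \<omega>\<^sup>2 * \<zeta> x) * Re (cnj (u x) * w x)\<bar>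
            \<le> K * ((norm (u x))\<^sup>2 + (norm (w x))\<^sup>2)"
        proof -
          have i: "inverse (\<zeta> x) \<le> inverse m" using z \<zeta>(1) by (simp add: le_imp_inverse_le)
          have "\<omega>\<^sup>2 * \<zeta> x \<le> \<omega>\<^sup>2 * M" using z by (simp add: mult_left_mono)
          moreover have "0 \<le> inverse (\<zeta> x)" "0 \<le> \<omega>\<^sup>2 * \<zeta> x" using z0 by simp_all
          ultimately have 1: "\<bar>inverse (\<zeta> x) - \<omega>\<^sup>2 * \<zeta> x\<bar> \<le> K"
            using i unfolding K_def abs_le_iff by linarith
          have "\<bar>Re (cnj (u x) * w x)\<bar> \<le> norm (u x) * norm (w x)"
            using abs_Re_le_cmod[of "cnj (u x) * w x"] by (simp add: norm_mult)
          then have 2: "\<bar>2 * Re (cnj (u x) * w x)\<bar> \<le> (norm (u x))\<^sup>2 + (norm (w x))\<^sup>2"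
            using sum_squares_bound[of "norm (u x)" "norm (w x)"] by simp
          have "\<bar>inverse (\<zeta> x) - \<omega>\<^sup>2 * \<zeta> x\<bar> * \<bar>2 * Re (cnj (u x) * w x)\<bar>
             \<le> K * ((norm (u x))\<^sup>2 + (norm (w x))\<^sup>2)"
            using 1 2 by (intro mult_mono) auto
          moreover have "2 * (inverse (\<zeta> x) - \<omega>\<^sup>2 * \<zeta> x) * Re (cnj (u x) * w x)
             = (inverse (\<zeta> x) - \<omega>\<^sup>2 * \<zeta> x) * (2 * Re (cnj (u x) * w x))" by (simp only: mult_ac)
          ultimately show ?thesis by (simp only: abs_mult[symmetric])
        qed
        moreover have "Re ?E = (norm (u x))\<^sup>2 + (norm (w x))\<^sup>2"
          by (simp add: cmod_power2) (simp add: power2_eq_square)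
        ultimately have "0 \<le> Re ((cnj (u x) * d + cnj d * u x) + (cnj (w x) * e + cnj e * w x)) + K * Re ?E"
          by (rule aux)
        then have "0 \<le> exp (K * x) * (Re ((cnj (u x) * d + cnj d * u x) + (cnj (w x) * e + cnj e * w x)) + K * Re ?E)"
          by simp
        also have "\<dots> = Re ?D"
          by (simp only: plus_complex.sel Re_complex_of_real times_complex.sel Im_complex_of_real) (simp add: algebra_simps)
        finally show ?thesis .
      qed
      ultimately show ?case by blast
    qed
  qed (use ab in auto)
  moreover have "Re (?f x) = exp (K * x) * ((norm (u x))\<^sup>2 + (norm (w x))\<^sup>2)" for x
    by (simp add: cmod_power2) (simp add: power2_eq_square)
  ultimately show ?thesis by simp
qed

section \<open>Essential limits and uniqueness\<close>

text \<open>
  Neighbourhoods of \<open>p\<close> in \<open>X\<close> up to null sets; at an end point of an interval \<open>X\<close> this is the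
  one-sided essential limit.
\<close>

definition ess_at :: "real set \<Rightarrow> real \<Rightarrow> real filter" where
  "ess_at X p = inf (nhds p) (ae_filter (lebesgue_on X))"

lemma ess_at_AE: "AE x in lebesgue_on X. P x \<Longrightarrow> eventually P (ess_at X p)"
  unfolding ess_at_def by (rule filter_leD[OF inf_le2])

lemma ess_at_nhds: "eventually P (nhds p) \<Longrightarrow> eventually P (ess_at X p)"
  unfolding ess_at_def by (rule filter_leD[OF inf_le1])

lemma eventually_ess_at:
  "eventually P (ess_at X p) \<longleftrightarrow> (\<exists>d>0. AE x in lebesgue_on X. \<bar>x - p\<bar> < d \<longrightarrow> P x)" (is "?L = ?R")
proof
  assume ?L
  then obtain Q R where QR: "eventually Q (nhds p)" "AE x in lebesgue_on X. R x" "\<And>x. Q x \<and> R x \<longrightarrow> P x"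
    unfolding ess_at_def eventually_inf by blast
  then obtain d where "d > 0" "\<And>x. \<bar>x - p\<bar> < d \<Longrightarrow> Q x"
    unfolding eventually_nhds_metric by (auto simp: dist_real_def)
  moreover from QR(2) have "AE x in lebesgue_on X. \<bar>x - p\<bar> < d \<longrightarrow> P x"
    by eventually_elim (use QR(3) calculation in blast)
  ultimately show ?R by blast
next
  assume ?R
  then obtain d where d: "d > 0" "AE x in lebesgue_on X. \<bar>x - p\<bar> < d \<longrightarrow> P x" by blast
  have "eventually (\<lambda>x. \<bar>x - p\<bar> < d) (ess_at X p)"
    using d(1) by (intro ess_at_nhds) (auto simp: eventually_nhds_metric dist_real_def)
  with ess_at_AE[OF d(2)] show ?L by eventually_elim auto
qed

text \<open>Every ball around \<open>p\<close> meets \<open>X\<close> in a nonempty open set, which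
  is not null. Uniqueness of limits and the passage of inequalities to the limit rest on
  this.\<close>

lemma ess_at_neq_bot:
  assumes "open X" "p \<in> closure X"
  shows "ess_at X p \<noteq> bot"
proof
  assume "ess_at X p = bot"
  then have "eventually (\<lambda>_. False) (ess_at X p)" by simp
  then obtain d where d: "d > 0" "AE x in lebesgue_on X. \<bar>x - p\<bar> < d \<longrightarrow> False"
    unfolding eventually_ess_at by blast
  have X: "X \<in> sets lebesgue" using assms(1) by auto
  obtain N where N: "N \<in> null_sets lebesgue" "\<And>x. x \<in> X \<Longrightarrow> \<bar>x - p\<bar> < d \<Longrightarrow> x \<in> N"
    using AE_lebesgue_on_null[OF d(2) X] by metis
  have "X \<inter> ball p d \<subseteq> N" using N(2) by (auto simp: dist_real_def abs_minus_commute)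
  then have "negligible (X \<inter> ball p d)"
    using N(1) negligible_subset negligible_iff_null_sets by blast
  moreover have "X \<inter> ball p d \<noteq> {}"
  proof -
    obtain q where "q \<in> X" "dist q p < d" using assms(2) d(1) unfolding closure_approachable by blast
    then show ?thesis by (auto simp: dist_commute)
  qed
  ultimately show False using open_not_negligible[of "X \<inter> ball p d"] assms(1) by (simp add: open_Int)
qed

text \<open>The filter in \<open>limit_along_diff\<close> depends on \<open>u\<close>, so two
  solutions are not directly comparable. As \<open>u\<close> is differentiable almost everywhere,
  \<open>ess_at\<close> is finer and serves all solutions at once; \<open>p \<notin> X\<close>
  matters because \<open>at p within\<close> omits \<open>p\<close>.\<close>

lemma limit_along_diff_ess_at:
  assumes "limit_along_diff X u f c p" "p \<notin> X"
    and "AE x in lebesgue_on X. u differentiable (at x)"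
  shows "(f \<longlongrightarrow> c) (ess_at X p)"
proof -
  have "AE x in lebesgue_on X. x \<in> X" by (rule AE_I2) simp
  with assms(3) have "AE x in lebesgue_on X. x \<in> {x \<in> X. u differentiable (at x)} - {p}"
    by eventually_elim (use assms(2) in auto)
  then have "ess_at X p \<le> at p within {x \<in> X. u differentiable (at x)}"
    unfolding ess_at_def at_within_def by (intro inf_mono) (auto simp: le_principal)
  with assms(1) show ?thesis
    unfolding limit_along_diff_def by (rule tendsto_mono[rotated])
qed

section \<open>Wave amplitudes and the vanishing of homogeneous solutions\<close>

lemma solution_pair_differentiable:
  "solution_pair X \<zeta> \<omega> u w \<Longrightarrow> AE x in lebesgue_on X. u differentiable (at x)"
  unfolding solution_pair_def by (auto elim!: eventually_mono intro: differentiableI_vector)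

text \<open>Inverts the definitions of the two waves and eliminates \<open>u'\<close> through
  \<open>w\<close>, so that limits of the waves give control over \<open>u\<close> and
  \<open>w\<close>.\<close>

lemma solution_pair_waves:
  assumes "solution_pair X \<zeta> \<omega> u w" "\<omega> \<noteq> 0"
  shows "AE x in lebesgue_on X. u x = u_right \<omega> u x + u_left \<omega> u x \<and>
    w x = of_real (\<zeta> x) * (\<i> * of_real \<omega> * (u_right \<omega> u x - u_left \<omega> u x))"
proof -
  have "AE x in lebesgue_on X. \<exists>d. (u has_vector_derivative d) (at x) \<and> w x = of_real (\<zeta> x) * d"
    using assms(1) by (simp add: solution_pair_def)
  then show ?thesis
  proof eventually_elim
    case (elim x)
    then obtain d where d: "(u has_vector_derivative d) (at x)" "w x = of_real (\<zeta> x) * d" by blast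
    have "vector_derivative u (at x) = d" using d(1) by (rule vector_derivative_at)
    then have "\<i> * of_real \<omega> * (u_right \<omega> u x - u_left \<omega> u x) = d" "u x = u_right \<omega> u x + u_left \<omega> u x"
      using assms(2) by (simp_all add: u_right_def u_left_def field_simps)
    then show ?case using d(2) by simp
  qed
qed

text \<open>The cross terms \<open>cnj L * R - cnj R * L\<close> are purely imaginary and drop out
  after the factor \<open>\<i>\<close>, leaving the power of one wave minus that of the
  other.\<close>

lemma flux_waves:
  "Im (cnj (R + L) * (of_real z * (\<i> * of_real \<omega> * (R - L)))) = \<omega> * (z * ((norm R)\<^sup>2 - (norm L)\<^sup>2))"
  by (simp add: cmod_power2 algebra_simps) (simp add: power2_eq_square algebra_simps)

text \<open>Serves twice: for the difference of two solutions, and to exclude a vanishing amplitude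
  at \<open>x0\<close> in the existence proof.\<close>

lemma solution_pair_zero:
  assumes s: "solution_pair {x0<..<x1} \<zeta> \<omega> u w" and x01: "x0 < x1" and \<omega>: "\<omega> \<noteq> 0"
    and \<zeta>: "m > 0" "AE x in lebesgue_on {x0<..<x1}. m \<le> \<zeta> x \<and> \<zeta> x \<le> M"
    and R0: "(u_right \<omega> u \<longlongrightarrow> 0) (ess_at {x0<..<x1} x0)"
    and L1: "(u_left \<omega> u \<longlongrightarrow> \<xi> * r) (ess_at {x0<..<x1} x1)"
    and R1: "(u_right \<omega> u \<longlongrightarrow> r) (ess_at {x0<..<x1} x1)"
    and \<xi>: "norm \<xi> < 1" and x: "x \<in> {x0<..<x1}"
  shows "u x = 0"
proof -
  let ?X = "{x0<..<x1}"
  let ?R = "u_right \<omega> u" and ?L = "u_left \<omega> u"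
  have X: "?X \<in> sets lebesgue" by simp
  have nb: "ess_at ?X x0 \<noteq> bot" "ess_at ?X x1 \<noteq> bot"
    using x01 ess_at_neq_bot[of ?X x0] ess_at_neq_bot[of ?X x1] by simp_all
  note waves = solution_pair_waves[OF s \<omega>]
  \<comment> \<open>Division by \<open>\<omega>\<close> makes the sign argument independent of the
    sign of \<open>\<omega>\<close>.\<close>
  define k where "k = Im (cnj (u x) * w x) / \<omega>"
  have "Im (cnj (u y) * w y) = \<omega> * k" if "y \<in> ?X" for y
  proof (cases "x \<le> y")
    case True
    then show ?thesis using solution_pair_flux[OF s X, of x y] that x \<omega> by (simp add: k_def subset_eq)
  next
    case False
    then show ?thesis using solution_pair_flux[OF s X, of y x] that x \<omega> by (simp add: k_def subset_eq)
  qed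
  moreover have "AE y in lebesgue_on ?X. y \<in> ?X" by (rule AE_I2) simp
  ultimately have "AE y in lebesgue_on ?X. Im (cnj (u y) * w y) = \<omega> * k" by auto
  with waves have k: "AE y in lebesgue_on ?X. k = \<zeta> y * ((norm (?R y))\<^sup>2 - (norm (?L y))\<^sup>2)"
  proof eventually_elim
    case (elim y)
    then have "\<omega> * k = \<omega> * (\<zeta> y * ((norm (?R y))\<^sup>2 - (norm (?L y))\<^sup>2))"
      using flux_waves[of "?R y" "?L y" "\<zeta> y" \<omega>] by metis
    then show ?case using \<omega> by simp
  qed
  \<comment> \<open>At \<open>x0\<close>, dropping the left-going part and using
    \<open>\<zeta> \<le> M\<close> leaves a bound that tends to 0, whatever \<open>\<zeta>\<close>
    and the other wave do there.\<close>
  have "k \<le> M * (norm (0::complex))\<^sup>2"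
  proof (rule tendsto_lowerbound)
    show "((\<lambda>y. M * (norm (?R y))\<^sup>2) \<longlongrightarrow> M * (norm (0::complex))\<^sup>2) (ess_at ?X x0)"
      by (intro tendsto_intros R0)
    show "eventually (\<lambda>y. k \<le> M * (norm (?R y))\<^sup>2) (ess_at ?X x0)"
      using ess_at_AE[OF k] ess_at_AE[OF \<zeta>(2)]
    proof eventually_elim
      case (elim y)
      then have "\<zeta> y * (norm (?R y))\<^sup>2 \<le> M * (norm (?R y))\<^sup>2" "0 \<le> \<zeta> y * (norm (?L y))\<^sup>2"
        using \<zeta>(1) by (auto intro!: mult_right_mono mult_nonneg_nonneg)
      then show ?case using elim by (simp add: right_diff_distrib)
    qed
  qed (rule nb(1))
  then have k0: "k \<le> 0" by simp
  \<comment> \<open>Since \<open>k \<le> 0\<close> and \<open>\<zeta> > 0\<close>, the right-going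
    wave is nowhere the larger one, almost everywhere; at \<open>x1\<close> this contradicts
    \<open>norm \<xi> < 1\<close> unless \<open>r = 0\<close>.\<close>
  have "(norm r)\<^sup>2 - (norm (\<xi> * r))\<^sup>2 \<le> 0"
  proof (rule tendsto_upperbound)
    show "((\<lambda>y. (norm (?R y))\<^sup>2 - (norm (?L y))\<^sup>2) \<longlongrightarrow> (norm r)\<^sup>2 - (norm (\<xi> * r))\<^sup>2) (ess_at ?X x1)"
      by (intro tendsto_intros R1 L1)
    show "eventually (\<lambda>y. (norm (?R y))\<^sup>2 - (norm (?L y))\<^sup>2 \<le> 0) (ess_at ?X x1)"
      using ess_at_AE[OF k] ess_at_AE[OF \<zeta>(2)]
      by eventually_elim (use k0 \<zeta>(1) in \<open>auto simp: mult_le_0_iff\<close>)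
  qed (rule nb(2))
  then have "(1 - (norm \<xi>)\<^sup>2) * (norm r)\<^sup>2 \<le> 0"
    by (simp add: norm_mult power_mult_distrib algebra_simps)
  moreover have "0 < 1 - (norm \<xi>)\<^sup>2" using \<xi> by (simp add: abs_square_less_1)
  ultimately have "(norm r)\<^sup>2 \<le> 0" by (simp add: mult_le_0_iff)
  then have r: "r = 0" by simp
  define K where "K = inverse m + \<omega>\<^sup>2 * M"
  let ?E = "\<lambda>y. (norm (u y))\<^sup>2 + (norm (w y))\<^sup>2"
  \<comment> \<open>Majorant of the weighted energy in terms of the waves alone:
    \<open>\<zeta>\<close> is replaced by \<open>M\<close>, so the limit at \<open>x1\<close>
    follows from those of the waves and is 0 when \<open>r = 0\<close>.\<close>
  let ?B = "\<lambda>y. exp (K * y) * ((norm (?R y + ?L y))\<^sup>2 + M\<^sup>2 * \<omega>\<^sup>2 * (norm (?R y - ?L y))\<^sup>2)"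
  have "exp (K * x) * ?E x \<le> exp (K * x1) * ((norm (r + \<xi> * r))\<^sup>2 + M\<^sup>2 * \<omega>\<^sup>2 * (norm (r - \<xi> * r))\<^sup>2)"
  proof (rule tendsto_lowerbound)
    have "((\<lambda>y. y) \<longlongrightarrow> x1) (ess_at ?X x1)"
      unfolding ess_at_def filterlim_def by (simp add: filtermap_ident)
    then show "(?B \<longlongrightarrow> exp (K * x1) * ((norm (r + \<xi> * r))\<^sup>2 + M\<^sup>2 * \<omega>\<^sup>2 * (norm (r - \<xi> * r))\<^sup>2)) (ess_at ?X x1)"
      by (intro tendsto_intros R1 L1)
    have "eventually (\<lambda>y. y > x) (ess_at ?X x1)"
      using x eventually_nhds_in_open[of "{x<..}" x1] by (intro ess_at_nhds) simp
    moreover have "eventually (\<lambda>y. y \<in> ?X) (ess_at ?X x1)"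
      by (rule ess_at_AE, rule AE_I2) simp
    ultimately show "eventually (\<lambda>y. exp (K * x) * ?E x \<le> ?B y) (ess_at ?X x1)"
      using ess_at_AE[OF waves, of x1] ess_at_AE[OF \<zeta>(2), of x1]
    proof eventually_elim
      case (elim y)
      have "exp (K * x) * ?E x \<le> exp (K * y) * ?E y"
        unfolding K_def using elim x by (intro solution_pair_energy[OF s X _ _ \<zeta>]) (auto simp: subset_eq)
      also have "(norm (w y))\<^sup>2 = (\<zeta> y)\<^sup>2 * \<omega>\<^sup>2 * (norm (?R y - ?L y))\<^sup>2"
      proof -
        have "w y = of_real (\<zeta> y) * (\<i> * of_real \<omega> * (?R y - ?L y))" using elim by blast
        then show ?thesis by (simp only: norm_mult power_mult_distrib norm_of_real power2_abs) simp
      qed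
      also have "u y = ?R y + ?L y" using elim by blast
      also have "exp (K * y) * ((norm (?R y + ?L y))\<^sup>2 + (\<zeta> y)\<^sup>2 * \<omega>\<^sup>2 * (norm (?R y - ?L y))\<^sup>2) \<le> ?B y"
        using elim \<zeta>(1) by (intro mult_left_mono add_left_mono mult_right_mono power_mono) auto
      finally show ?case .
    qed
  qed (rule nb(2))
  then have "?E x \<le> 0" using r by (simp add: mult_le_0_iff)
  then have "(norm (u x))\<^sup>2 \<le> 0" using zero_le_power2[of "norm (w x)"] by linarith
  then show ?thesis by simp
qed

section \<open>Essential limits of regulated functions\<close>

text \<open>Cauchy's criterion in the complete space of reals. The centres \<open>c\<close> are
  complex because the step functions approximating a real function are complex valued.\<close>

lemma ess_limit_exists:
  fixes f :: "real \<Rightarrow> real"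
  assumes "ess_at X p \<noteq> bot"
    and "\<And>e. e > 0 \<Longrightarrow> \<exists>c. eventually (\<lambda>x. norm (complex_of_real (f x) - c) \<le> e) (ess_at X p)"
  shows "\<exists>c. (f \<longlongrightarrow> c) (ess_at X p)"
proof -
  have "cauchy_filter (filtermap f (ess_at X p))"
    unfolding cauchy_filter_metric_filtermap
  proof (intro allI impI)
    fix e :: real assume "e > 0"
    then obtain c where c: "eventually (\<lambda>x. norm (complex_of_real (f x) - c) \<le> e / 3) (ess_at X p)"
      using assms(2)[of "e / 3"] by auto
    show "\<exists>P. eventually P (ess_at X p) \<and> (\<forall>x y. P x \<and> P y \<longrightarrow> dist (f x) (f y) < e)"
    proof (intro exI conjI allI impI)
      fix x y
      assume a: "norm (complex_of_real (f x) - c) \<le> e / 3 \<and> norm (complex_of_real (f y) - c) \<le> e / 3"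
      have "norm (complex_of_real (f x) - complex_of_real (f y)) \<le> e / 3 + e / 3"
        using a norm_triangle_ineq4[of "complex_of_real (f x) - c" "complex_of_real (f y) - c"] by simp
      then show "dist (f x) (f y) < e"
        using \<open>e > 0\<close> unfolding dist_real_def of_real_diff[symmetric] norm_of_real by simp
    qed (rule c)
  qed
  moreover have "filtermap f (ess_at X p) \<noteq> bot" using assms(1) by (simp add: filtermap_bot_iff)
  ultimately show ?thesis
    using complete_UNIV[where 'a = real] unfolding complete_uniform filterlim_def by auto
qed

lemma Reg_locally_almost_constant:
  assumes "f \<in> Reg {a<..<b}"
  obtains s P where "\<And>n::nat. finite (P n)"
    "\<And>n. AE x in lebesgue_on {a<..<b}. norm (f x - s n x) \<le> 1 / real (Suc n)"
    "\<And>n p. p \<notin> P n \<inter> {a<..<b} \<Longrightarrow> \<exists>d>0. \<forall>x\<in>{a<..<b}. \<forall>y\<in>{a<..<b}. \<bar>x - p\<bar> < d \<longrightarrow> \<bar>y - p\<bar> < d \<longrightarrow> s n x = s n y"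
proof -
  let ?X = "{a<..<b}"
  have "\<forall>n. \<exists>s. s \<in> Step ?X \<and> (AE x in lebesgue_on ?X. norm (f x - s x) \<le> 1 / real (Suc n))"
    using assms by (auto simp: Reg_def Bex_def)
  then obtain s where s: "\<And>n. s n \<in> Step ?X" "\<And>n. AE x in lebesgue_on ?X. norm (f x - s n x) \<le> 1 / real (Suc n)"
    by metis
  have "\<forall>n. \<exists>P. finite P \<and> (\<forall>x\<in>?X. \<forall>y\<in>?X. x < y \<longrightarrow> {x..y} \<inter> P = {} \<longrightarrow> s n x = s n y)"
    using s(1) by (simp add: Step_def)
  then obtain P where P: "\<And>n. finite (P n)"
    "\<And>n x y. x \<in> ?X \<Longrightarrow> y \<in> ?X \<Longrightarrow> x < y \<Longrightarrow> {x..y} \<inter> P n = {} \<Longrightarrow> s n x = s n y"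
    by metis
  show thesis
  proof (rule that[of P s])
    fix n p assume p: "p \<notin> P n \<inter> ?X"
    \<comment> \<open>Only \<open>p\<close> itself may remain as a jump in the ball. A jump at
      \<open>p\<close> between two points of \<open>?X\<close> would put \<open>p\<close> into
      \<open>P n \<inter> ?X\<close>.\<close>
    have "open (- (P n - {p}))" by (intro open_Compl finite_imp_closed finite_Diff P(1))
    then obtain d where d: "d > 0" "ball p d \<subseteq> - (P n - {p})"
      by (metis ComplI Diff_iff openE singletonI)
    have *: "s n x = s n y" if "x \<in> ?X" "y \<in> ?X" "\<bar>x - p\<bar> < d" "\<bar>y - p\<bar> < d" "x < y" for x y
    proof (rule P(2))
      show "{x..y} \<inter> P n = {}"
      proof (rule ccontr)
        assume "{x..y} \<inter> P n \<noteq> {}"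
        then obtain z where z: "x \<le> z" "z \<le> y" "z \<in> P n" by auto
        then have "z \<in> ball p d" using that by (auto simp: dist_real_def)
        then have "z = p" using d(2) z(3) by blast
        then show False using z that p by auto
      qed
    qed (use that in auto)
    show "\<exists>d>0. \<forall>x\<in>?X. \<forall>y\<in>?X. \<bar>x - p\<bar> < d \<longrightarrow> \<bar>y - p\<bar> < d \<longrightarrow> s n x = s n y"
    proof (intro exI[of _ d] conjI ballI impI)
      fix x y assume "x \<in> ?X" "y \<in> ?X" "\<bar>x - p\<bar> < d" "\<bar>y - p\<bar> < d"
      then show "s n x = s n y" using *[of x y] *[of y x] by (metis linorder_neqE_linordered_idom)
    qed (rule d(1))
  qed (rule P(1), rule s(2))
qed

lemma Reg_one_sided_limit:
  fixes f :: "real \<Rightarrow> real"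
  assumes f: "(\<lambda>x. complex_of_real (f x)) \<in> Reg {a<..<b}" and ab: "a < b" and p: "p = a \<or> p = b"
  shows "\<exists>c. (f \<longlongrightarrow> c) (ess_at {a<..<b} p)"
proof (rule ess_limit_exists)
  let ?X = "{a<..<b}"
  show "ess_at ?X p \<noteq> bot" using ab p by (intro ess_at_neq_bot) auto
  obtain s P where "\<And>n::nat. finite (P n)"
    and s: "\<And>n. AE x in lebesgue_on ?X. norm (complex_of_real (f x) - s n x) \<le> 1 / real (Suc n)"
    and loc: "\<And>n p. p \<notin> P n \<inter> ?X \<Longrightarrow> \<exists>d>0. \<forall>x\<in>?X. \<forall>y\<in>?X. \<bar>x - p\<bar> < d \<longrightarrow> \<bar>y - p\<bar> < d \<longrightarrow> s n x = s n y"
    by (rule Reg_locally_almost_constant[OF f]) (rule that)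
  fix e :: real assume "e > 0"
  then obtain n where n: "1 / real (Suc n) < e" using nat_approx_posE by blast
  obtain d where d: "d > 0" "\<forall>x\<in>?X. \<forall>y\<in>?X. \<bar>x - p\<bar> < d \<longrightarrow> \<bar>y - p\<bar> < d \<longrightarrow> s n x = s n y"
    using loc[of p n] p by auto
  have "p \<in> closure ?X" using ab p by auto
  \<comment> \<open>The end point is outside \<open>?X\<close>, so the constant value of the step
    function near it is read off at a nearby \<open>q\<close>.\<close>
  then obtain q where q: "q \<in> ?X" "\<bar>q - p\<bar> < d"
    using d(1) unfolding closure_approachable dist_real_def by blast
  show "\<exists>c. eventually (\<lambda>x. norm (complex_of_real (f x) - c) \<le> e) (ess_at ?X p)"
  proof (intro exI)
    have "AE x in lebesgue_on ?X. x \<in> ?X" by (rule AE_I2) simp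
    with s[of n] have "AE x in lebesgue_on ?X. \<bar>x - p\<bar> < d \<longrightarrow> norm (complex_of_real (f x) - s n q) \<le> e"
    proof eventually_elim
      case (elim x)
      show ?case
      proof
        assume "\<bar>x - p\<bar> < d"
        then have "s n x = s n q" using d(2) q elim by blast
        then show "norm (complex_of_real (f x) - s n q) \<le> e" using elim n by simp
      qed
    qed
    then show "eventually (\<lambda>x. norm (complex_of_real (f x) - s n q) \<le> e) (ess_at ?X p)"
      using d(1) unfolding eventually_ess_at by blast
  qed
qed

text \<open>Outside the countable union of the jump sets and the null set where some approximation
  fails, \<open>f\<close> is within \<open>2 / Suc n\<close> of \<open>f p\<close> almost everywhere
  near \<open>p\<close>, for every \<open>n\<close>. Continuity in this essential sense is enough to
  differentiate an integral at \<open>p\<close>.\<close>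

lemma Reg_AE_continuous:
  fixes f :: "real \<Rightarrow> real"
  assumes f: "(\<lambda>x. complex_of_real (f x)) \<in> Reg {a<..<b}"
  shows "AE p in lebesgue_on {a<..<b}. (f \<longlongrightarrow> f p) (ess_at {a<..<b} p)"
proof -
  let ?X = "{a<..<b}"
  obtain s P where P: "\<And>n::nat. finite (P n)"
    and s: "\<And>n. AE x in lebesgue_on ?X. norm (complex_of_real (f x) - s n x) \<le> 1 / real (Suc n)"
    and loc: "\<And>n p. p \<notin> P n \<inter> ?X \<Longrightarrow> \<exists>d>0. \<forall>x\<in>?X. \<forall>y\<in>?X. \<bar>x - p\<bar> < d \<longrightarrow> \<bar>y - p\<bar> < d \<longrightarrow> s n x = s n y"
    by (rule Reg_locally_almost_constant[OF f]) (rule that)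
  have "countable (\<Union>n. P n)" using P by (auto intro: countable_finite)
  then have "(\<Union>n. P n) \<in> null_sets lebesgue"
    by (intro null_sets_completionI countable_imp_null_set_lborel)
  then have "AE x in lebesgue. x \<notin> (\<Union>n. P n)" by (rule AE_not_in)
  then have "AE x in lebesgue_on ?X. x \<notin> (\<Union>n. P n)" by (subst AE_restrict_space_iff) auto
  moreover have "AE x in lebesgue_on ?X. \<forall>n. norm (complex_of_real (f x) - s n x) \<le> 1 / real (Suc n)"
    using s by (simp add: AE_all_countable)
  moreover have X: "AE x in lebesgue_on ?X. x \<in> ?X" by (rule AE_I2) simp
  ultimately show ?thesis
  proof eventually_elim
    case (elim p)
    show ?case
    proof (rule tendstoI)
      fix e :: real assume "e > 0"
      then obtain n where n: "1 / real (Suc n) < e / 2" using nat_approx_posE[of "e / 2"] by auto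
      obtain d where d: "d > 0" "\<forall>x\<in>?X. \<forall>y\<in>?X. \<bar>x - p\<bar> < d \<longrightarrow> \<bar>y - p\<bar> < d \<longrightarrow> s n x = s n y"
        using loc[of p n] elim by auto
      have "AE x in lebesgue_on ?X. \<bar>x - p\<bar> < d \<longrightarrow> dist (f x) (f p) < e"
        using s[of n] X
      proof eventually_elim
        case (elim x)
        show ?case
        proof
          assume "\<bar>x - p\<bar> < d"
          moreover have "\<bar>p - p\<bar> < d" using d(1) by simp
          ultimately have e: "s n x = s n p" using d(2) elim(2) \<open>p \<in> ?X\<close> by blast
          have fp: "norm (complex_of_real (f p) - s n p) \<le> 1 / real (Suc n)"
            using \<open>\<forall>n. norm (complex_of_real (f p) - s n p) \<le> 1 / real (Suc n)\<close> by blast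
          have "norm (complex_of_real (f x) - complex_of_real (f p)) \<le> 1 / real (Suc n) + 1 / real (Suc n)"
          proof -
            have "complex_of_real (f x) - complex_of_real (f p)
                = (complex_of_real (f x) - s n x) - (complex_of_real (f p) - s n p)" using e by simp
            then show ?thesis
              using norm_triangle_ineq4 add_mono[OF elim(1) fp] order_trans by metis
          qed
          then show "dist (f x) (f p) < e"
            using n unfolding dist_real_def of_real_diff[symmetric] norm_of_real by simp
        qed
      qed
      then show "eventually (\<lambda>x. dist (f x) (f p) < e) (ess_at ?X p)"
        using d(1) unfolding eventually_ess_at by blast
    qed
  qed
qed

section \<open>Pointwise derivatives of indefinite integrals\<close>

lemma indefinite_integral_increment:
  fixes g h :: "real \<Rightarrow> complex"
  assumes g: "g integrable_on {a..b}" and h: "\<And>t. t \<in> {a..b} \<Longrightarrow> h t = c - integral {t..b} g"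
    and yz: "y \<in> {a..b}" "z \<in> {a..b}" "y \<le> z"
  shows "(g has_integral h z - h y) {y..z}"
proof -
  have "integral {y..z} g + integral {z..b} g = integral {y..b} g"
    using yz by (intro Henstock_Kurzweil_Integration.integral_combine integrable_on_subinterval[OF g]) auto
  then have "h z - h y = integral {y..z} g" unfolding h[OF yz(1)] h[OF yz(2)] by (simp flip: \<open>_ = integral {y..b} g\<close>)
  moreover have "g integrable_on {y..z}" using yz by (intro integrable_on_subinterval[OF g]) auto
  ultimately show ?thesis by (simp add: has_integral_integral)
qed

text \<open>Both \<open>y\<close> and \<open>z\<close> vary near \<open>p\<close>. This two-point
  form yields the derivative at an interior \<open>p\<close> and also bounds the derivatives at
  nearby points, even when \<open>p\<close> is an end point.\<close>

lemma indefinite_integral_strong_derivative: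
  fixes g h :: "real \<Rightarrow> complex"
  assumes g: "g integrable_on {a..b}" and h: "\<And>t. t \<in> {a..b} \<Longrightarrow> h t = c - integral {t..b} g"
    and lim: "(g \<longlongrightarrow> k) (ess_at {a<..<b} p)" and e: "e > 0"
  shows "\<exists>d>0. \<forall>y\<in>{a..b}. \<forall>z\<in>{a..b}. \<bar>y - p\<bar> < d \<longrightarrow> \<bar>z - p\<bar> < d \<longrightarrow>
    norm (h z - h y - (z - y) *\<^sub>R k) \<le> e * \<bar>z - y\<bar>"
proof -
  have "eventually (\<lambda>x. dist (g x) k < e) (ess_at {a<..<b} p)" using lim e by (rule tendstoD)
  then obtain d where d: "d > 0" "AE x in lebesgue_on {a<..<b}. \<bar>x - p\<bar> < d \<longrightarrow> dist (g x) k < e"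
    unfolding eventually_ess_at by blast
  obtain N where N: "N \<in> null_sets lebesgue"
    "\<And>x. x \<in> {a<..<b} \<Longrightarrow> x \<notin> N \<Longrightarrow> \<bar>x - p\<bar> < d \<Longrightarrow> dist (g x) k < e"
    using AE_lebesgue_on_null[OF d(2)] by auto
  \<comment> \<open>The essential bound on \<open>g\<close> concerns the open interval only, so the
    end points join the exceptional set.\<close>
  have neg: "negligible (N \<union> {a, b})" using N(1) by (simp add: negligible_iff_null_sets)
  have *: "norm (h z - h y - (z - y) *\<^sub>R k) \<le> e * (z - y)"
    if yz: "y \<in> {a..b}" "z \<in> {a..b}" "\<bar>y - p\<bar> < d" "\<bar>z - p\<bar> < d" "y \<le> z" for y z
  proof -
    have "((\<lambda>x. g x - k) has_integral (h z - h y) - (z - y) *\<^sub>R k) {y..z}"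
      using has_integral_const_real[of k y z] yz
      by (intro has_integral_diff indefinite_integral_increment[OF g h]) auto
    then have "((\<lambda>x. if x \<in> N \<union> {a, b} then 0 else g x - k) has_integral (h z - h y) - (z - y) *\<^sub>R k) {y..z}"
      by (rule has_integral_spike[OF neg, rotated]) auto
    then have "norm (h z - h y - (z - y) *\<^sub>R k) \<le> e * measure lborel {y..z}"
    proof (rule has_integral_bound_real[where S = "{}", rotated 2])
      show "norm (if x \<in> N \<union> {a, b} then 0 else g x - k) \<le> e" if "x \<in> {y..z} - {}" for x
        using N(2)[of x] that yz e by (auto simp: dist_norm less_imp_le)
    qed (use e in auto)
    then show ?thesis using yz by simp
  qed
  show ?thesis
  proof (intro exI[of _ d] conjI ballI impI)
    fix y z assume yz: "y \<in> {a..b}" "z \<in> {a..b}" "\<bar>y - p\<bar> < d" "\<bar>z - p\<bar> < d"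
    show "norm (h z - h y - (z - y) *\<^sub>R k) \<le> e * \<bar>z - y\<bar>"
    proof (cases "y \<le> z")
      case True then show ?thesis using *[of y z] yz by simp
    next
      case False
      have "h z - h y - (z - y) *\<^sub>R k = - (h y - h z - (y - z) *\<^sub>R k)" by (simp add: algebra_simps)
      then have "norm (h z - h y - (z - y) *\<^sub>R k) = norm (h y - h z - (y - z) *\<^sub>R k)"
        by (metis norm_minus_cancel)
      then show ?thesis using *[of z y] yz False by simp
    qed
  qed (rule d(1))
qed

lemma indefinite_integral_has_vector_derivative:
  fixes g h :: "real \<Rightarrow> complex"
  assumes g: "g integrable_on {a..b}" and h: "\<And>t. t \<in> {a..b} \<Longrightarrow> h t = c - integral {t..b} g"
    and lim: "(g \<longlongrightarrow> k) (ess_at {a<..<b} p)" and p: "p \<in> {a<..<b}"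
  shows "(h has_vector_derivative k) (at p)"
  unfolding has_vector_derivative_def has_derivative_at_alt
proof (intro conjI allI impI)
  fix e :: real assume "e > 0"
  then obtain d where d: "d > 0" "\<forall>y\<in>{a..b}. \<forall>z\<in>{a..b}. \<bar>y - p\<bar> < d \<longrightarrow> \<bar>z - p\<bar> < d \<longrightarrow>
    norm (h z - h y - (z - y) *\<^sub>R k) \<le> e * \<bar>z - y\<bar>"
    using indefinite_integral_strong_derivative[OF g h lim] by blast
  show "\<exists>d>0. \<forall>y. norm (y - p) < d \<longrightarrow> norm (h y - h p - (y - p) *\<^sub>R k) \<le> e * norm (y - p)"
  \<comment> \<open>The distances to \<open>a\<close> and \<open>b\<close> keep \<open>y\<close>
    inside \<open>{a..b}\<close>, where \<open>h\<close> is given by the integral.\<close>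
  proof (intro exI[of _ "min d (min (p - a) (b - p))"] conjI allI impI)
    fix y assume "norm (y - p) < min d (min (p - a) (b - p))"
    then show "norm (h y - h p - (y - p) *\<^sub>R k) \<le> e * norm (y - p)"
      using d(2)[rule_format, of p y] p d(1) by (auto simp: abs_less_iff)
  qed (use d(1) p in auto)
qed (rule bounded_linear_scaleR_left)

text \<open>Gives the one-sided limits required by \<open>limit_along_diff\<close>. A derivative
  existing at \<open>x\<close> near \<open>p\<close> is a limit of difference quotients near
  \<open>p\<close>, and these are close to \<open>k\<close> by the two-point estimate.\<close>

lemma indefinite_integral_derivative_limit:
  fixes g h :: "real \<Rightarrow> complex"
  assumes g: "g integrable_on {a..b}" and h: "\<And>t. t \<in> {a..b} \<Longrightarrow> h t = c - integral {t..b} g"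
    and lim: "(g \<longlongrightarrow> k) (ess_at {a<..<b} p)"
  shows "((\<lambda>x. vector_derivative h (at x)) \<longlongrightarrow> k) (at p within {x \<in> {a<..<b}. h differentiable (at x)})"
proof (rule tendstoI)
  fix e :: real assume e: "e > 0"
  then obtain d where d: "d > 0" "\<forall>y\<in>{a..b}. \<forall>z\<in>{a..b}. \<bar>y - p\<bar> < d \<longrightarrow> \<bar>z - p\<bar> < d \<longrightarrow>
    norm (h z - h y - (z - y) *\<^sub>R k) \<le> e / 2 * \<bar>z - y\<bar>"
    using indefinite_integral_strong_derivative[OF g h lim, of "e / 2"] by auto
  have "dist (vector_derivative h (at x)) k < e"
    if x: "x \<in> {a<..<b}" "h differentiable (at x)" "dist x p < d" for x
  proof -
    define D where "D = vector_derivative h (at x)"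
    have "(h has_vector_derivative D) (at x)"
      using x(2) by (simp add: vector_derivative_works D_def)
    then obtain d' where d': "d' > 0"
      "\<And>z. norm (z - x) < d' \<Longrightarrow> norm (h z - h x - (z - x) *\<^sub>R D) \<le> e / 4 * norm (z - x)"
      unfolding has_vector_derivative_def has_derivative_at_alt using e by (metis zero_less_divide_iff zero_less_numeral)
    have "open ({a<..<b} \<inter> ball p d \<inter> ball x d')" by (intro open_Int) auto
    moreover have "x \<in> {a<..<b} \<inter> ball p d \<inter> ball x d'" using x d'(1) by (auto simp: dist_commute)
    ultimately obtain r where r: "r > 0" "cball x r \<subseteq> {a<..<b} \<inter> ball p d \<inter> ball x d'"
      by (meson open_contains_cball)
    \<comment> \<open>One increment is compared with both slopes: error \<open>e / 2\<close> for
      \<open>k\<close> and \<open>e / 4\<close> for \<open>D\<close>, hence at most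
      \<open>3 * e / 4\<close>, which is below \<open>e\<close>.\<close>
    let ?z = "x + r"
    have "?z \<in> cball x r" using r(1) by (simp add: dist_real_def)
    then have z: "?z \<in> {a<..<b}" "dist p ?z < d" "dist x ?z < d'" using r(2) by auto
    have "norm (h ?z - h x - (?z - x) *\<^sub>R k) \<le> e / 2 * r"
      using d(2)[rule_format, of x ?z] z x r(1) by (auto simp: dist_real_def abs_minus_commute)
    moreover have "norm (h ?z - h x - (?z - x) *\<^sub>R D) \<le> e / 4 * r"
      using d'(2)[of ?z] z(3) r(1) by (simp add: dist_real_def)
    ultimately have "norm ((h ?z - h x - (?z - x) *\<^sub>R k) - (h ?z - h x - (?z - x) *\<^sub>R D)) \<le> e / 2 * r + e / 4 * r"
      by (rule order_trans[OF norm_triangle_ineq4 add_mono])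
    also have "(h ?z - h x - (?z - x) *\<^sub>R k) - (h ?z - h x - (?z - x) *\<^sub>R D) = r *\<^sub>R (D - k)"
      by (simp add: algebra_simps)
    finally have "r * norm (D - k) \<le> e / 2 * r + e / 4 * r" using r(1) by (simp only: norm_scaleR)
    also have "\<dots> = r * (e * 3 / 4)" by (simp add: field_simps)
    finally have "norm (D - k) \<le> e * 3 / 4" using r(1) by (simp only: mult_le_cancel_left_pos)
    then show ?thesis using e by (simp add: dist_norm D_def)
  qed
  then show "eventually (\<lambda>x. dist (vector_derivative h (at x)) k < e)
      (at p within {x \<in> {a<..<b}. h differentiable (at x)})"
    unfolding eventually_at using d(1) by blast
qed

section \<open>Existence for the terminal value problem\<close>

text \<open>
  Picard's operator on \<open>[a, b]\<close>, written for \<open>exp (-2K(b - t)) y(t)\<close> and extended to the real line by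
  clamping, is a contraction with factor \<open>1/2\<close> on the bounded continuous functions.
\<close>

lemma caratheodory_backward:
  fixes F :: "real \<Rightarrow> 'a::euclidean_space \<Rightarrow> 'a"
  assumes ab: "a \<le> b" and K: "K > 0"
    and meas: "\<And>g. continuous_on {a..b} g \<Longrightarrow> (\<lambda>s. F s (g s)) \<in> borel_measurable (lebesgue_on {a..b})"
    and lip: "\<And>s x y. s \<in> {a..b} \<Longrightarrow> norm (F s x - F s y) \<le> K * norm (x - y)"
    and zero: "\<And>s. s \<in> {a..b} \<Longrightarrow> F s 0 = 0"
  obtains y where "continuous_on {a..b} y"
    "\<And>t. t \<in> {a..b} \<Longrightarrow> y t = c - integral {t..b} (\<lambda>s. F s (y s))"
proof -
  \<comment> \<open>The integral of \<open>K * exp (L * (b - s))\<close> over \<open>{t..b}\<close>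
    is \<open>K / L * (exp (L * (b - t)) - 1)\<close>, so \<open>L = 2 * K\<close> produces the
    contraction factor 1/2.\<close>
  define L where "L = 2 * K"
  have L: "L > 0" using K by (simp add: L_def)
  define cl where "cl t = max a (min b t)" for t :: real
  have cl: "cl t \<in> {a..b}" for t using ab by (auto simp: cl_def)
  have cl_id: "cl t = t" if "t \<in> {a..b}" for t using that by (auto simp: cl_def)
  \<comment> \<open>The Lipschitz condition and \<open>F s 0 = 0\<close> give linear growth, hence
    an integrable bound.\<close>
  have ai: "(\<lambda>s. F s (g s)) absolutely_integrable_on {a..b}" if g: "continuous_on {a..b} g" for g
  proof (rule measurable_bounded_by_integrable_imp_absolutely_integrable)
    show "(\<lambda>s. K * norm (g s)) integrable_on {a..b}"
      using g by (intro integrable_continuous_interval continuous_intros)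
    show "norm (F s (g s)) \<le> K * norm (g s)" if "s \<in> {a..b}" for s
      using lip[OF that, of "g s" 0] zero[OF that] by simp
  qed (use meas[OF g] in auto)
  define ex where "ex s = exp (L * (b - s))" for s
  have ex0: "ex s > 0" for s by (simp add: ex_def)
  have excont: "continuous_on S ex" for S unfolding ex_def by (intro continuous_intros)
  have wcont: "continuous_on {a..b} (\<lambda>s. ex s *\<^sub>R apply_bcontfun g s)" for g :: "real \<Rightarrow>\<^sub>C 'a"
    by (intro continuous_on_scaleR excont continuous_on_apply_bcontfun)
  have wint: "(\<lambda>s. F s (ex s *\<^sub>R apply_bcontfun g s)) integrable_on {t..b}" if "t \<in> {a..b}" for g :: "real \<Rightarrow>\<^sub>C 'a" and t
    using ai[OF wcont[of g]] that
    by (meson absolutely_integrable_on_def atLeastAtMost_iff atLeastatMost_subset_iff integrable_on_subinterval order_refl)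
  define P where "P g t = inverse (ex t) *\<^sub>R (c - integral {t..b} (\<lambda>s. F s (ex s *\<^sub>R apply_bcontfun g s)))"
    for g :: "real \<Rightarrow>\<^sub>C 'a" and t
  have Pcont: "continuous_on {a..b} (P g)" for g
    unfolding P_def using ex0 ab
    by (intro continuous_intros excont indefinite_integral_continuous_1' wint) (auto simp: less_imp_neq[symmetric])
  have PB: "(\<lambda>t. P g (cl t)) \<in> bcontfun" for g
  proof -
    have "bounded (P g ` {a..b})"
      by (intro compact_imp_bounded compact_continuous_image Pcont) auto
    then obtain B where B: "\<And>t. t \<in> {a..b} \<Longrightarrow> norm (P g t) \<le> B" by (force simp: bounded_iff)
    show ?thesis
    proof (rule bcontfun_normI)
      show "continuous_on UNIV (\<lambda>t. P g (cl t))"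
      proof (rule continuous_on_compose2[OF Pcont])
        show "continuous_on UNIV cl" unfolding cl_def by (intro continuous_intros)
      qed (use cl in auto)
    qed (use B cl in auto)
  qed
  define Phi where "Phi g = Bcontfun (\<lambda>t. P g (cl t))" for g
  have Phi: "apply_bcontfun (Phi g) t = P g (cl t)" for g t
    unfolding Phi_def using PB by (simp add: Bcontfun_inverse)
  have contr: "dist (Phi g) (Phi h) \<le> 1/2 * dist g h" for g h
  proof (rule dist_bound)
    fix t
    let ?t = "cl t"
    have t: "?t \<in> {a..b}" by (rule cl)
    have I: "((\<lambda>s. K * (ex s * dist g h)) has_integral (ex ?t - 1) / 2 * dist g h) {?t..b}"
    proof -
      have "((\<lambda>s. K * (ex s * dist g h)) has_integral
         (- ex b / 2 * dist g h) - (- ex ?t / 2 * dist g h)) {?t..b}"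
        using t L K unfolding ex_def
        by (intro fundamental_theorem_of_calculus)
           (auto simp: L_def has_real_derivative_iff_has_vector_derivative[symmetric] intro!: derivative_eq_intros)
      then show ?thesis by (simp add: ex_def algebra_simps diff_divide_distrib)
    qed
    have "norm (integral {?t..b} (\<lambda>s. F s (ex s *\<^sub>R apply_bcontfun g s) - F s (ex s *\<^sub>R apply_bcontfun h s)))
        \<le> integral {?t..b} (\<lambda>s. K * (ex s * dist g h))"
    proof (rule integral_norm_bound_integral)
      show "(\<lambda>s. F s (ex s *\<^sub>R apply_bcontfun g s) - F s (ex s *\<^sub>R apply_bcontfun h s)) integrable_on {?t..b}"
        using wint[OF t] by (intro integrable_diff)
      show "(\<lambda>s. K * (ex s * dist g h)) integrable_on {?t..b}" using I by blast
      fix s assume s: "s \<in> {?t..b}"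
      have "norm (F s (ex s *\<^sub>R apply_bcontfun g s) - F s (ex s *\<^sub>R apply_bcontfun h s))
          \<le> K * norm (ex s *\<^sub>R apply_bcontfun g s - ex s *\<^sub>R apply_bcontfun h s)"
        using s t by (intro lip) auto
      also have "\<dots> = K * (ex s * dist (apply_bcontfun g s) (apply_bcontfun h s))"
        using ex0[of s] by (simp add: scaleR_diff_right[symmetric] dist_norm)
      also have "\<dots> \<le> K * (ex s * dist g h)"
        using ex0[of s] K by (intro mult_left_mono dist_bounded) auto
      finally show "norm (F s (ex s *\<^sub>R apply_bcontfun g s) - F s (ex s *\<^sub>R apply_bcontfun h s))
          \<le> K * (ex s * dist g h)" .
    qed
    also have "\<dots> = (ex ?t - 1) / 2 * dist g h" using I by (rule integral_unique)
    finally have 1: "norm (integral {?t..b} (\<lambda>s. F s (ex s *\<^sub>R apply_bcontfun g s))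
        - integral {?t..b} (\<lambda>s. F s (ex s *\<^sub>R apply_bcontfun h s))) \<le> (ex ?t - 1) / 2 * dist g h"
      by (subst (asm) integral_diff) (use wint[OF t] in auto)
    have "dist (P g ?t) (P h ?t) = inverse (ex ?t) * norm (integral {?t..b} (\<lambda>s. F s (ex s *\<^sub>R apply_bcontfun g s))
        - integral {?t..b} (\<lambda>s. F s (ex s *\<^sub>R apply_bcontfun h s)))"
      using ex0[of ?t] unfolding P_def dist_norm scaleR_diff_right[symmetric]
      by (simp add: norm_minus_commute)
    also have "\<dots> \<le> inverse (ex ?t) * ((ex ?t - 1) / 2 * dist g h)"
      using 1 ex0[of ?t] by (intro mult_left_mono) auto
    also have "\<dots> = (1 - inverse (ex ?t)) * (1/2 * dist g h)"
      using ex0[of ?t] by (simp add: field_simps)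
    also have "\<dots> \<le> 1 * (1/2 * dist g h)"
      using ex0[of ?t] by (intro mult_right_mono) auto
    finally show "dist (apply_bcontfun (Phi g) t) (apply_bcontfun (Phi h) t) \<le> 1/2 * dist g h"
      by (simp add: Phi)
  qed
  have "\<exists>!g. Phi g = g"
    by (rule banach_fix_type[of "1/2"]) (use contr in auto)
  then obtain g where g: "Phi g = g" by auto
  define y where "y s = ex s *\<^sub>R apply_bcontfun g s" for s
  show thesis
  proof (rule that)
    show "continuous_on {a..b} y" unfolding y_def by (rule wcont)
    fix t assume t: "t \<in> {a..b}"
    have "apply_bcontfun g t = P g t" using Phi[of g t] cl_id[OF t] g by simp
    then show "y t = c - integral {t..b} (\<lambda>s. F s (y s))"
      using ex0[of t] by (simp add: y_def P_def)
  qed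
qed

lemma Reg_plus_bounds:
  assumes "\<zeta> \<in> Reg_plus X"
  obtains m M where "m > 0" "AE x in lebesgue_on X. m \<le> \<zeta> x \<and> \<zeta> x \<le> M"
    "\<zeta> \<in> borel_measurable (lebesgue_on X)"
proof -
  have L: "(\<lambda>x. complex_of_real (\<zeta> x)) \<in> Linf X" using assms by (auto simp: Reg_plus_def Reg_def)
  then obtain C where "AE x in lebesgue_on X. norm (complex_of_real (\<zeta> x)) \<le> C"
    by (auto simp: Linf_def)
  moreover obtain m where m: "m > 0" "\<forall>x\<in>X. m < \<zeta> x" using assms by (auto simp: Reg_plus_def)
  then have "AE x in lebesgue_on X. m < \<zeta> x" by (intro AE_I2) (auto simp: space_restrict_space)
  ultimately have "AE x in lebesgue_on X. m \<le> \<zeta> x \<and> \<zeta> x \<le> C" by eventually_elim auto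
  moreover have "(\<lambda>x. Re (complex_of_real (\<zeta> x))) \<in> borel_measurable (lebesgue_on X)"
    using L by (intro borel_measurable_continuous_on[where f = Re]) (auto simp: Linf_def intro: continuous_intros)
  then have "\<zeta> \<in> borel_measurable (lebesgue_on X)" by simp
  ultimately show ?thesis using m(1) that by blast
qed

lemma tendsto_ess_at_continuous_on:
  fixes f :: "real \<Rightarrow> 'a::topological_space"
  assumes "continuous_on {a..b} f" "p \<in> {a..b}"
  shows "(f \<longlongrightarrow> f p) (ess_at {a<..<b} p)"
proof -
  have "(f \<longlongrightarrow> f p) (at p within {a..b})" using assms by (simp add: continuous_on_def)
  then have "(f \<longlongrightarrow> f p) (inf (nhds p) (principal {a..b}))"
    by (simp add: tendsto_at_within_iff_tendsto_nhds)
  moreover have "AE x in lebesgue_on {a<..<b}. x \<in> {a..b}" by (rule AE_I2) auto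
  then have "ess_at {a<..<b} p \<le> inf (nhds p) (principal {a..b})"
    unfolding ess_at_def by (intro inf_mono) (auto simp: le_principal)
  ultimately show ?thesis by (rule tendsto_mono[rotated])
qed

lemma AC_on_indefinite_integral:
  fixes g h :: "real \<Rightarrow> complex"
  assumes g: "g integrable_on {a..b}" and h: "\<And>t. t \<in> {a..b} \<Longrightarrow> h t = c - integral {t..b} g"
    and B: "\<And>x. x \<in> {a..b} \<Longrightarrow> norm (g x) \<le> B" "0 \<le> B"
  shows "AC_on {a<..<b} h"
proof (rule AC_on_Lipschitz)
  have *: "norm (h z - h y) \<le> B * (z - y)" if "y \<in> {a..b}" "z \<in> {a..b}" "y \<le> z" for y z
  proof -
    have "norm (h z - h y) \<le> B * measure lborel {y..z}"
      using that B by (intro has_integral_bound_real[where S = "{}", OF _ _ indefinite_integral_increment[OF g h]]) auto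
    then show ?thesis using that by simp
  qed
  show "norm (h x - h y) \<le> B * \<bar>x - y\<bar>" if "x \<in> {a<..<b}" "y \<in> {a<..<b}" for x y
    using *[of x y] *[of y x] that by (cases "x \<le> y") (auto simp: norm_minus_commute)
qed (rule B(2))

text \<open>Integral form of the system \<open>u' = w / \<zeta>\<close>,
  \<open>w' = - \<omega>\<^sup>2 * \<zeta> * u\<close>, started at \<open>b\<close>. The integrands
  \<open>gu\<close> and \<open>gw\<close> are exported so that the integrals can be differentiated
  once essential limits of \<open>\<zeta>\<close> are available.\<close>

lemma terminal_value_problem:
  assumes ab: "a < b" and \<zeta>: "\<zeta> \<in> borel_measurable (lebesgue_on {a<..<b})"
    and m: "m > 0" "AE x in lebesgue_on {a<..<b}. m \<le> \<zeta> x \<and> \<zeta> x \<le> M"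
  obtains u w gu gw where "continuous_on {a..b} u" "continuous_on {a..b} w" "u b = u1" "w b = w1"
    "AC_on {a<..<b} u" "AC_on {a<..<b} w"
    "gu integrable_on {a..b}" "\<And>t. t \<in> {a..b} \<Longrightarrow> u t = u1 - integral {t..b} gu"
    "gw integrable_on {a..b}" "\<And>t. t \<in> {a..b} \<Longrightarrow> w t = w1 - integral {t..b} gw"
    "AE x in lebesgue_on {a<..<b}. gu x = w x / of_real (\<zeta> x)"
    "AE x in lebesgue_on {a<..<b}. gw x = - of_real (\<omega>\<^sup>2 * \<zeta> x) * u x"
proof -
  let ?X = "{a<..<b}"
  \<comment> \<open>The bounds on \<open>\<zeta>\<close> hold only almost everywhere, but the
    contraction argument needs a Lipschitz bound at every point of \<open>{a..b}\<close>. The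
    default \<open>m\<close> repairs the exceptional points and the end points, and is the reason
    for the maximum in \<open>N\<close>.\<close>
  define z where "z x = (if x \<in> ?X \<and> m \<le> \<zeta> x \<and> \<zeta> x \<le> M then \<zeta> x else m)" for x
  define N where "N = max m M"
  have z: "m \<le> z x" "z x \<le> N" "0 < z x" "z x \<noteq> 0" for x
    using m(1) by (auto simp: z_def N_def)
  have N: "N > 0" using m(1) by (simp add: N_def)
  have X: "AE x in lebesgue_on ?X. x \<in> ?X" by (rule AE_I2) simp
  have z\<zeta>: "AE x in lebesgue_on ?X. z x = \<zeta> x"
    using m(2) X by eventually_elim (auto simp: z_def)
  \<comment> \<open>Writing \<open>z\<close> as \<open>m\<close> plus a function extended by 0
    carries measurability from the open interval to the closed one.\<close>
  define q where "q x = (if m \<le> \<zeta> x \<and> \<zeta> x \<le> M then \<zeta> x - m else 0)" for x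
  have "q \<in> borel_measurable (lebesgue_on ?X)" unfolding q_def using \<zeta> by measurable
  then have "(\<lambda>x. indicator ?X x *\<^sub>R q x) \<in> borel_measurable lebesgue"
    by (subst (asm) borel_measurable_restrict_space_iff) auto
  then have "(\<lambda>x. m + indicator ?X x *\<^sub>R q x) \<in> borel_measurable lebesgue" by measurable
  moreover have "z = (\<lambda>x. m + indicator ?X x *\<^sub>R q x)" by (auto simp: z_def q_def indicator_def)
  ultimately have zm: "z \<in> borel_measurable (lebesgue_on {a..b})"
    by (simp add: measurable_restrict_space1)
  define F where "F s y = (snd y / complex_of_real (z s), - of_real (\<omega>\<^sup>2 * z s) * fst y)"
    for s and y :: "complex \<times> complex"
  define K where "K = inverse m + \<omega>\<^sup>2 * N"
  have K: "K > 0" using m(1) N by (auto simp: K_def intro!: add_pos_nonneg)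
  have Fbound: "norm (F s y) \<le> K * norm y" for s y
  proof -
    have "norm (F s y) \<le> norm (snd y / complex_of_real (z s)) + norm (of_real (\<omega>\<^sup>2 * z s) * fst y)"
      unfolding F_def using norm_Pair_le by (metis minus_mult_left norm_minus_cancel)
    also have "\<dots> = norm (snd y) * inverse (z s) + \<omega>\<^sup>2 * z s * norm (fst y)"
      using z(3)[of s] by (simp add: norm_mult norm_divide norm_inverse abs_mult divide_inverse del: of_real_mult of_real_power)
    also have "\<dots> \<le> norm y * inverse m + \<omega>\<^sup>2 * N * norm y"
      using z[of s] m(1) N norm_snd_le[of "snd y" "fst y"] norm_fst_le[of "fst y" "snd y"]
      by (intro add_mono mult_mono le_imp_inverse_le) auto
    finally show ?thesis by (simp add: K_def algebra_simps)
  qed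
  have Fdiff: "F s x - F s y = F s (x - y)" for s x y
    by (simp add: F_def algebra_simps diff_divide_distrib)
  have Fmeas: "(\<lambda>s. F s (g s)) \<in> borel_measurable (lebesgue_on {a..b})" if g: "continuous_on {a..b} g" for g
  proof -
    note zm[measurable]
    have [measurable]: "(\<lambda>s. fst (g s)) \<in> borel_measurable (lebesgue_on {a..b})"
      "(\<lambda>s. snd (g s)) \<in> borel_measurable (lebesgue_on {a..b})"
      using g by (auto intro!: continuous_imp_measurable_on_sets_lebesgue continuous_intros)
    show ?thesis unfolding F_def by (intro borel_measurable_Pair) measurable
  qed
  obtain y where y: "continuous_on {a..b} y"
    "\<And>t. t \<in> {a..b} \<Longrightarrow> y t = (u1, w1) - integral {t..b} (\<lambda>s. F s (y s))"
  proof (rule caratheodory_backward[of a b K F "(u1, w1)"])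
    show "norm (F s x - F s y) \<le> K * norm (x - y)" for s x y unfolding Fdiff by (rule Fbound)
    show "F s 0 = 0" for s by (simp add: F_def zero_prod_def)
  qed (use ab K Fmeas in auto)
  have Fy: "(\<lambda>s. F s (y s)) absolutely_integrable_on {a..b}"
  proof (rule measurable_bounded_by_integrable_imp_absolutely_integrable)
    show "(\<lambda>s. K * norm (y s)) integrable_on {a..b}"
      using y(1) by (intro integrable_continuous_interval continuous_intros)
  qed (use Fmeas[OF y(1)] Fbound in auto)
  then have Fi: "(\<lambda>s. F s (y s)) integrable_on {t..b}" if "t \<in> {a..b}" for t
    using that by (intro integrable_on_subinterval[OF set_lebesgue_integral_eq_integral(1)]) auto
  have "bounded (y ` {a..b})" using y(1) by (intro compact_imp_bounded compact_continuous_image) auto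
  then obtain B where B: "\<And>x. x \<in> {a..b} \<Longrightarrow> norm (y x) \<le> B" by (force simp: bounded_iff)
  have FB: "norm (F x (y x)) \<le> K * B" if "x \<in> {a..b}" for x
    using order_trans[OF Fbound mult_left_mono[OF B[OF that] less_imp_le[OF K]]] .
  have KB: "0 \<le> K * B" using order_trans[OF norm_ge_zero FB[of a]] ab by simp
  define u w gu gw where "u = (\<lambda>t. fst (y t))" and "w = (\<lambda>t. snd (y t))"
    and "gu = (\<lambda>s. fst (F s (y s)))" and "gw = (\<lambda>s. snd (F s (y s)))"
  have gi: "gu integrable_on {a..b}" "gw integrable_on {a..b}"
    using integrable_linear[OF Fi[of a] bounded_linear_fst] integrable_linear[OF Fi[of a] bounded_linear_snd] ab
    by (simp_all add: gu_def gw_def o_def)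
  have ieq: "u t = u1 - integral {t..b} gu" "w t = w1 - integral {t..b} gw" if "t \<in> {a..b}" for t
    using integral_linear[OF Fi[OF that] bounded_linear_fst] integral_linear[OF Fi[OF that] bounded_linear_snd] y(2)[OF that]
    by (simp_all add: u_def w_def gu_def gw_def o_def)
  show thesis
  proof (rule that)
    show "continuous_on {a..b} u" "continuous_on {a..b} w"
      unfolding u_def w_def by (intro continuous_intros y(1))+
    show "u b = u1" "w b = w1" using ieq[of b] ab by auto
    show "AC_on ?X u"
    proof (rule AC_on_indefinite_integral[OF gi(1) ieq(1) _ KB])
      show "norm (gu x) \<le> K * B" if "x \<in> {a..b}" for x
        using FB[OF that] norm_fst_le[of "fst (F x (y x))" "snd (F x (y x))"] by (simp add: gu_def)
    qed
    show "AC_on ?X w"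
    proof (rule AC_on_indefinite_integral[OF gi(2) ieq(2) _ KB])
      show "norm (gw x) \<le> K * B" if "x \<in> {a..b}" for x
        using FB[OF that] norm_snd_le[of "snd (F x (y x))" "fst (F x (y x))"] by (simp add: gw_def)
    qed
    show "AE x in lebesgue_on ?X. gu x = w x / of_real (\<zeta> x)"
      "AE x in lebesgue_on ?X. gw x = - of_real (\<omega>\<^sup>2 * \<zeta> x) * u x"
      using z\<zeta> by (eventually_elim, simp add: gu_def gw_def F_def u_def w_def)+
  qed (use gi ieq in auto)
qed

text \<open>Prescribing both waves at \<open>b\<close> amounts to prescribing \<open>u\<close> and
  \<open>w\<close> there, once \<open>w\<close> is converted with the limit \<open>\<zeta>b\<close>.
  The limit of \<open>\<zeta>\<close> at \<open>a\<close> conversely makes the amplitude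
  \<open>\<rho>\<close> exist.\<close>

lemma terminal_wave_solution:
  assumes ab: "a < b" and \<zeta>: "\<zeta> \<in> Reg_plus {a<..<b}" and \<omega>: "\<omega> \<noteq> 0"
  obtains u w \<rho> where "solution_pair {a<..<b} \<zeta> \<omega> u w"
    "limit_along_diff {a<..<b} u (u_right \<omega> u) \<rho> a"
    "limit_along_diff {a<..<b} u (u_left \<omega> u) l b"
    "limit_along_diff {a<..<b} u (u_right \<omega> u) r b"
proof -
  let ?X = "{a<..<b}"
  obtain m M where m: "m > 0" "AE x in lebesgue_on ?X. m \<le> \<zeta> x \<and> \<zeta> x \<le> M"
    and meas: "\<zeta> \<in> borel_measurable (lebesgue_on ?X)"
    by (rule Reg_plus_bounds[OF \<zeta>])
  have reg: "(\<lambda>x. complex_of_real (\<zeta> x)) \<in> Reg ?X" using \<zeta> by (simp add: Reg_plus_def)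
  obtain \<zeta>a \<zeta>b where z: "(\<zeta> \<longlongrightarrow> \<zeta>a) (ess_at ?X a)" "(\<zeta> \<longlongrightarrow> \<zeta>b) (ess_at ?X b)"
    using Reg_one_sided_limit[OF reg ab] by blast
  have nb: "ess_at ?X a \<noteq> bot" "ess_at ?X b \<noteq> bot"
    using ab ess_at_neq_bot[of ?X a] ess_at_neq_bot[of ?X b] by simp_all
  have m': "eventually (\<lambda>x. m \<le> \<zeta> x) (ess_at ?X p)" for p
    using ess_at_AE[OF m(2)] by eventually_elim auto
  have z0: "\<zeta>a \<noteq> 0" "\<zeta>b \<noteq> 0"
    using tendsto_lowerbound[OF z(1) m' nb(1)] tendsto_lowerbound[OF z(2) m' nb(2)] m(1) by auto
  obtain u w gu gw where cont: "continuous_on {a..b} u" "continuous_on {a..b} w"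
    and T: "u b = r + l" "w b = of_real \<zeta>b * (\<i> * of_real \<omega> * (r - l))"
    and AC: "AC_on ?X u" "AC_on ?X w"
    and u: "gu integrable_on {a..b}" "\<And>t. t \<in> {a..b} \<Longrightarrow> u t = r + l - integral {t..b} gu"
    and w: "gw integrable_on {a..b}"
      "\<And>t. t \<in> {a..b} \<Longrightarrow> w t = of_real \<zeta>b * (\<i> * of_real \<omega> * (r - l)) - integral {t..b} gw"
    and gu: "AE x in lebesgue_on ?X. gu x = w x / of_real (\<zeta> x)"
    and gw: "AE x in lebesgue_on ?X. gw x = - of_real (\<omega>\<^sup>2 * \<zeta> x) * u x"
    by (rule terminal_value_problem[OF ab meas m]) (rule that)
  \<comment> \<open>Used with \<open>c\<close> equal to \<open>\<zeta> p\<close> at almost every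
    interior point, for the equation, and with \<open>\<zeta>a\<close> and \<open>\<zeta>b\<close>
    at the end points, for the boundary limits.\<close>
  have gu_lim: "(gu \<longlongrightarrow> w p / of_real c) (ess_at ?X p)"
    if "p \<in> {a..b}" "(\<zeta> \<longlongrightarrow> c) (ess_at ?X p)" "c \<noteq> 0" for p c
  proof -
    have "((\<lambda>x. w x / of_real (\<zeta> x)) \<longlongrightarrow> w p / of_real c) (ess_at ?X p)"
      using that by (intro tendsto_intros tendsto_ess_at_continuous_on cont) auto
    moreover have "eventually (\<lambda>x. w x / of_real (\<zeta> x) = gu x) (ess_at ?X p)"
      using ess_at_AE[OF gu] by eventually_elim simp
    ultimately show ?thesis by (rule Lim_transform_eventually)
  qed
  have gw_lim: "(gw \<longlongrightarrow> - of_real (\<omega>\<^sup>2 * c) * u p) (ess_at ?X p)"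
    if "p \<in> {a..b}" "(\<zeta> \<longlongrightarrow> c) (ess_at ?X p)" for p c
  proof -
    have "((\<lambda>x. - of_real (\<omega>\<^sup>2 * \<zeta> x) * u x) \<longlongrightarrow> - of_real (\<omega>\<^sup>2 * c) * u p) (ess_at ?X p)"
      using that by (intro tendsto_intros tendsto_ess_at_continuous_on cont) auto
    moreover have "eventually (\<lambda>x. - of_real (\<omega>\<^sup>2 * \<zeta> x) * u x = gw x) (ess_at ?X p)"
      using ess_at_AE[OF gw] by eventually_elim simp
    ultimately show ?thesis by (rule Lim_transform_eventually)
  qed
  have X: "AE x in lebesgue_on ?X. x \<in> ?X" by (rule AE_I2) simp
  have s: "solution_pair ?X \<zeta> \<omega> u w"
    unfolding solution_pair_def
  proof (intro conjI AC)
    show "AE x in lebesgue_on ?X. \<exists>d. (u has_vector_derivative d) (at x) \<and> w x = of_real (\<zeta> x) * d"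
      using Reg_AE_continuous[OF reg] m(2) X
    proof eventually_elim
      case (elim x)
      then have "(u has_vector_derivative w x / of_real (\<zeta> x)) (at x)"
        using m(1) by (intro indefinite_integral_has_vector_derivative[OF u] gu_lim) auto
      then show ?case using elim m(1) by (intro exI[of _ "w x / of_real (\<zeta> x)"]) auto
    qed
    show "AE x in lebesgue_on ?X. \<exists>d. (w has_vector_derivative d) (at x) \<and> d + of_real (\<omega>\<^sup>2 * \<zeta> x) * u x = 0"
      using Reg_AE_continuous[OF reg] m(2) X
    proof eventually_elim
      case (elim x)
      then have "(w has_vector_derivative - of_real (\<omega>\<^sup>2 * \<zeta> x) * u x) (at x)"
        by (intro indefinite_integral_has_vector_derivative[OF w] gw_lim) auto
      then show ?case by (intro exI[of _ "- of_real (\<omega>\<^sup>2 * \<zeta> x) * u x"]) auto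
    qed
  qed
  have lims: "limit_along_diff ?X u (u_left \<omega> u) (1/2 * (u p - 1 / (\<i> * of_real \<omega>) * (w p / of_real c))) p"
    "limit_along_diff ?X u (u_right \<omega> u) (1/2 * (u p + 1 / (\<i> * of_real \<omega>) * (w p / of_real c))) p"
    if p: "p \<in> {a..b}" and c: "(\<zeta> \<longlongrightarrow> c) (ess_at ?X p)" "c \<noteq> 0" for p c
  proof -
    let ?F = "at p within {x \<in> ?X. u differentiable (at x)}"
    have 1: "((\<lambda>x. vector_derivative u (at x)) \<longlongrightarrow> w p / of_real c) ?F"
      by (rule indefinite_integral_derivative_limit[OF u gu_lim[OF p c]])
    have "(u \<longlongrightarrow> u p) (at p within {a..b})" using cont(1) p by (simp add: continuous_on_def)
    then have 2: "(u \<longlongrightarrow> u p) ?F" by (rule tendsto_within_subset) auto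
    show "limit_along_diff ?X u (u_left \<omega> u) (1/2 * (u p - 1 / (\<i> * of_real \<omega>) * (w p / of_real c))) p"
      "limit_along_diff ?X u (u_right \<omega> u) (1/2 * (u p + 1 / (\<i> * of_real \<omega>) * (w p / of_real c))) p"
      unfolding limit_along_diff_def u_left_def u_right_def by (intro tendsto_intros 1 2)+
  qed
  have "1/2 * (u b - 1 / (\<i> * of_real \<omega>) * (w b / of_real \<zeta>b)) = l"
    "1/2 * (u b + 1 / (\<i> * of_real \<omega>) * (w b / of_real \<zeta>b)) = r"
    unfolding T using z0 \<omega> by (simp_all add: field_simps)
  then show ?thesis using that[OF s lims(2)[OF _ z(1) z0(1)]] lims[OF _ z(2) z0(2)] ab by simp
qed

section \<open>The exceptional set contains zero\<close>

lemma const_L2: "(\<lambda>_. c) \<in> L2 {a<..<b}"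
proof -
  interpret finite_measure "lebesgue_on {a<..<b}"
    by (rule finite_measure_lebesgue_on) simp
  show ?thesis by (simp add: L2_def)
qed

lemma L2_diff:
  assumes "f \<in> L2 X" "g \<in> L2 X"
  shows "(\<lambda>x. f x - g x) \<in> L2 X"
proof -
  have [measurable]: "f \<in> borel_measurable (lebesgue_on X)" "g \<in> borel_measurable (lebesgue_on X)"
    using assms by (auto simp: L2_def)
  have "integrable (lebesgue_on X) (\<lambda>x. (norm (f x - g x))\<^sup>2)"
  proof (rule Bochner_Integration.integrable_bound)
    show "integrable (lebesgue_on X) (\<lambda>x. 2 * (norm (f x))\<^sup>2 + 2 * (norm (g x))\<^sup>2)"
      using assms by (auto simp: L2_def)
    have "(norm (f x - g x))\<^sup>2 \<le> 2 * (norm (f x))\<^sup>2 + 2 * (norm (g x))\<^sup>2" for x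
    proof -
      have "(norm (f x - g x))\<^sup>2 \<le> (norm (f x) + norm (g x))\<^sup>2"
        by (intro power_mono norm_triangle_ineq4) auto
      also have "\<dots> \<le> 2 * (norm (f x))\<^sup>2 + 2 * (norm (g x))\<^sup>2"
        using sum_squares_bound[of "norm (f x)" "norm (g x)"] by (simp add: power2_sum)
      finally show ?thesis .
    qed
    then show "AE x in lebesgue_on X. norm ((norm (f x - g x))\<^sup>2) \<le> norm (2 * (norm (f x))\<^sup>2 + 2 * (norm (g x))\<^sup>2)"
      by simp
  qed measurable
  then show ?thesis by (auto simp: L2_def)
qed

text \<open>The bounded factor \<open>z\<close> stands for the weight \<open>\<zeta>\<close> in
  inner products and for test functions and their derivatives in weak derivatives.\<close>

lemma L2_mult_integrable:
  assumes "f \<in> L2 X" "g \<in> L2 X" and z: "z \<in> borel_measurable (lebesgue_on X)"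
    and "AE x in lebesgue_on X. norm (z x) \<le> M"
  shows "integrable (lebesgue_on X) (\<lambda>x. z x * f x * g x :: complex)"
proof (rule Bochner_Integration.integrable_bound)
  have [measurable]: "f \<in> borel_measurable (lebesgue_on X)" "g \<in> borel_measurable (lebesgue_on X)"
    "z \<in> borel_measurable (lebesgue_on X)"
    using assms by (auto simp: L2_def)
  show "(\<lambda>x. z x * f x * g x) \<in> borel_measurable (lebesgue_on X)" by measurable
  show "integrable (lebesgue_on X) (\<lambda>x. \<bar>M\<bar> * ((norm (f x))\<^sup>2 + (norm (g x))\<^sup>2))"
    using assms by (auto simp: L2_def)
  show "AE x in lebesgue_on X. norm (z x * f x * g x) \<le> norm (\<bar>M\<bar> * ((norm (f x))\<^sup>2 + (norm (g x))\<^sup>2))"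
    using assms(4)
  proof eventually_elim
    case (elim x)
    have "2 * (norm (f x) * norm (g x)) \<le> (norm (f x))\<^sup>2 + (norm (g x))\<^sup>2"
      using sum_squares_bound[of "norm (f x)" "norm (g x)"] by (simp add: mult.assoc)
    then have "norm (f x) * norm (g x) \<le> (norm (f x))\<^sup>2 + (norm (g x))\<^sup>2"
      using mult_nonneg_nonneg[OF norm_ge_zero[of "f x"] norm_ge_zero[of "g x"]] by linarith
    then have "norm (z x) * (norm (f x) * norm (g x)) \<le> \<bar>M\<bar> * ((norm (f x))\<^sup>2 + (norm (g x))\<^sup>2)"
      using elim by (intro mult_mono) auto
    then show ?case by (simp add: norm_mult mult.assoc)
  qed
qed

lemma L2_inner_weighted_diff:
  assumes "f \<in> L2 X" "g \<in> L2 X" "h \<in> L2 X" "\<zeta> \<in> borel_measurable (lebesgue_on X)"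
    and "AE x in lebesgue_on X. \<bar>\<zeta> x\<bar> \<le> M"
  shows "L2_inner X (\<lambda>x. of_real (\<zeta> x) * (f x - g x)) h
    = L2_inner X (\<lambda>x. of_real (\<zeta> x) * f x) h - L2_inner X (\<lambda>x. of_real (\<zeta> x) * g x) h"
proof -
  note assms(4)[measurable]
  have hm: "h \<in> borel_measurable (lebesgue_on X)"
    using assms by (auto simp: L2_def)
  have "(\<lambda>x. cnj (h x)) \<in> borel_measurable (lebesgue_on X)"
    by (rule borel_measurable_continuous_on[OF _ hm]) (intro continuous_intros)
  then have h: "(\<lambda>x. cnj (h x)) \<in> L2 X"
    using assms(3) by (auto simp: L2_def)
  have i: "integrable (lebesgue_on X) (\<lambda>x. of_real (\<zeta> x) * k x * cnj (h x))" if "k \<in> L2 X" for k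
    using L2_mult_integrable[OF that h, of "\<lambda>x. of_real (\<zeta> x)" M] assms(5) by simp
  show ?thesis
    unfolding L2_inner_def
    by (subst Bochner_Integration.integral_diff[symmetric]) (use i assms(1,2) in \<open>auto simp: algebra_simps\<close>)
qed

lemma test_fun_facts:
  assumes "test_fun {a<..<b} \<phi>"
  shows "continuous_on S \<phi>" "continuous_on S (deriv \<phi>)" "(\<phi> has_field_derivative deriv \<phi> x) (at x)"
    "x \<notin> {a<..<b} \<Longrightarrow> \<phi> x = 0"
proof -
  have d: "\<phi> field_differentiable at x" "deriv \<phi> field_differentiable at x" for x
    using assms unfolding test_fun_def by (metis funpow_0, metis funpow_0 funpow_simps_right(2) comp_apply One_nat_def)
  show "continuous_on S \<phi>" "continuous_on S (deriv \<phi>)"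
    using d by (auto intro!: continuous_at_imp_continuous_on field_differentiable_imp_continuous_at)
  show "(\<phi> has_field_derivative deriv \<phi> x) (at x)" using d by (simp add: DERIV_deriv_iff_field_differentiable)
  show "x \<notin> {a<..<b} \<Longrightarrow> \<phi> x = 0" using assms by (auto simp: test_fun_def)
qed

lemma L2_times_bounded_continuous:
  assumes "f \<in> L2 {a<..<b}" "continuous_on UNIV \<phi>"
  shows "integrable (lebesgue_on {a<..<b}) (\<lambda>x. f x * complex_of_real (\<phi> x))"
proof -
  have "bounded (\<phi> ` {a..b})" using assms(2)
    by (intro compact_imp_bounded compact_continuous_image) (auto intro: continuous_on_subset)
  then obtain B where B: "\<And>x. x \<in> {a..b} \<Longrightarrow> \<bar>\<phi> x\<bar> \<le> B" by (force simp: bounded_iff)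
  have m: "(\<lambda>x. complex_of_real (\<phi> x)) \<in> borel_measurable (lebesgue_on {a<..<b})"
    using assms(2) by (intro continuous_imp_measurable_on_sets_lebesgue) (auto intro!: continuous_intros intro: continuous_on_subset)
  have "integrable (lebesgue_on {a<..<b}) (\<lambda>x. complex_of_real (\<phi> x) * f x * 1)"
    by (rule L2_mult_integrable[OF assms(1) const_L2 m, of B]) (rule AE_I2, use B in auto)
  then show ?thesis by (simp add: mult.commute)
qed

lemma W12_diff:
  assumes "W12 {a<..<b} u u'" "W12 {a<..<b} v v'"
  shows "W12 {a<..<b} (\<lambda>x. u x - v x) (\<lambda>x. u' x - v' x)"
  unfolding W12_def
proof (intro conjI allI impI)
  note W = assms[unfolded W12_def]
  show "(\<lambda>x. u x - v x) \<in> L2 {a<..<b}" "(\<lambda>x. u' x - v' x) \<in> L2 {a<..<b}"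
    using W by (auto intro: L2_diff)
  fix \<phi> assume \<phi>: "test_fun {a<..<b} \<phi>"
  have 1: "integrable (lebesgue_on {a<..<b}) (\<lambda>x. f x * complex_of_real (\<phi> x))"
    "integrable (lebesgue_on {a<..<b}) (\<lambda>x. f x * complex_of_real (deriv \<phi> x))"
    if "f \<in> L2 {a<..<b}" for f
    using that test_fun_facts(1,2)[OF \<phi>, of UNIV] by (auto intro!: L2_times_bounded_continuous)
  have "(LINT x|lebesgue_on {a<..<b}. u x * of_real (deriv \<phi> x)) = - (LINT x|lebesgue_on {a<..<b}. u' x * of_real (\<phi> x))"
    "(LINT x|lebesgue_on {a<..<b}. v x * of_real (deriv \<phi> x)) = - (LINT x|lebesgue_on {a<..<b}. v' x * of_real (\<phi> x))"
    using W \<phi> by auto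
  then show "(LINT x|lebesgue_on {a<..<b}. (u x - v x) * of_real (deriv \<phi> x)) =
        - (LINT x|lebesgue_on {a<..<b}. (u' x - v' x) * of_real (\<phi> x))"
    using W by (simp add: left_diff_distrib 1)
qed

lemma W12_const:
  assumes "a < b" shows "W12 {a<..<b} (\<lambda>x. c) (\<lambda>x. 0)"
  unfolding W12_def
proof (intro conjI allI impI)
  show "(\<lambda>x. c) \<in> L2 {a<..<b}" "(\<lambda>x. 0) \<in> L2 {a<..<b}" by (rule const_L2)+
  fix \<phi> assume \<phi>: "test_fun {a<..<b} \<phi>"
  let ?g = "\<lambda>x. c * complex_of_real (deriv \<phi> x)"
  have "(?g has_integral c * of_real (\<phi> b) - c * of_real (\<phi> a)) {a..b}"
  proof (rule fundamental_theorem_of_calculus)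
    fix x
    show "((\<lambda>x. c * of_real (\<phi> x)) has_vector_derivative ?g x) (at x within {a..b})"
      using has_field_derivative_at_within[OF test_fun_facts(3)[OF \<phi>]]
      by (intro has_vector_derivative_mult_right has_vector_derivative_of_real)
  qed (use assms in auto)
  then have "(?g has_integral 0) {a..b}" using test_fun_facts(4)[OF \<phi>] by simp
  then have "(?g has_integral 0) {a<..<b}" by (simp add: has_integral_Icc_iff_Ioo)
  have "integrable (lebesgue_on {a<..<b}) ?g"
    using const_L2 test_fun_facts(2)[OF \<phi>, of UNIV] by (rule L2_times_bounded_continuous)
  then have "(LINT x|lebesgue_on {a<..<b}. ?g x) = 0"
    using \<open>(?g has_integral 0) {a<..<b}\<close>
    by (intro has_integral_unique[OF has_integral_integral_lebesgue_on]) simp_all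
  then show "(LINT x|lebesgue_on {a<..<b}. c * of_real (deriv \<phi> x)) =
        - (LINT x|lebesgue_on {a<..<b}. 0 * of_real (\<phi> x))" by simp
qed

text \<open>\<open>A0\<close> is a choice, so its value is known only through uniqueness: the
  constant solves the variational problem with derivative 0, and any other solution agrees with it
  almost everywhere.\<close>

lemma A0_const:
  assumes "a < b" and \<zeta>: "\<zeta> \<in> borel_measurable (lebesgue_on {a<..<b})"
    and m: "m > 0" "AE x in lebesgue_on {a<..<b}. m \<le> \<zeta> x \<and> \<zeta> x \<le> M"
  shows "AE x in lebesgue_on {a<..<b}. A0 {a<..<b} \<zeta> (\<lambda>_. c) x = c"
proof -
  let ?X = "{a<..<b}" let ?M = "lebesgue_on ?X"
  define Q where "Q f \<longleftrightarrow> (\<exists>f'. W12 ?X f f' \<and> (\<forall>v v'. W12 ?X v v' \<longrightarrow>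
        L2_inner ?X (\<lambda>x. of_real (\<zeta> x) * f x) v + L2_inner ?X (\<lambda>x. of_real (\<zeta> x) * f' x) v' =
        L2_inner ?X (\<lambda>x. of_real (\<zeta> x) * c) v))" for f
  have A: "A0 ?X \<zeta> (\<lambda>_. c) = (SOME f. Q f)"
    unfolding A0_def Q_def ..
  note Wc = W12_const[OF assms(1), of c]
  have "Q (\<lambda>_. c)"
    unfolding Q_def by (intro exI[of _ "\<lambda>_. 0"] conjI Wc) (simp add: L2_inner_def)
  then have "Q (A0 ?X \<zeta> (\<lambda>_. c))" unfolding A by (rule someI[of Q])
  then obtain f f' where f: "A0 ?X \<zeta> (\<lambda>_. c) = f" and W: "W12 ?X f f'"
    and eq: "\<And>v v'. W12 ?X v v' \<Longrightarrow>
        L2_inner ?X (\<lambda>x. of_real (\<zeta> x) * f x) v + L2_inner ?X (\<lambda>x. of_real (\<zeta> x) * f' x) v' =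
        L2_inner ?X (\<lambda>x. of_real (\<zeta> x) * c) v"
    unfolding Q_def by blast
  let ?d = "\<lambda>x. f x - c"
  have Wd: "W12 ?X ?d f'" using W12_diff[OF W Wc] by simp
  have L: "f \<in> L2 ?X" "(\<lambda>_. c) \<in> L2 ?X" "?d \<in> L2 ?X" "f' \<in> L2 ?X"
    using W Wc Wd by (auto simp: W12_def)
  have bd: "AE x in ?M. \<bar>\<zeta> x\<bar> \<le> M" using m(2) by eventually_elim (use m(1) in auto)
  \<comment> \<open>Testing with the difference \<open>f - c\<close> itself, whose weak derivative
    is \<open>f'\<close>, makes a sum of two nonnegative weighted squares vanish.\<close>
  have "p + q = r \<Longrightarrow> s = p - r \<Longrightarrow> s + q = 0" for p q r s :: complex
    by auto
  from this[OF eq[OF Wd] L2_inner_weighted_diff[OF L(1,2,3) \<zeta> bd]]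
  have "L2_inner ?X (\<lambda>x. of_real (\<zeta> x) * ?d x) ?d + L2_inner ?X (\<lambda>x. of_real (\<zeta> x) * f' x) f' = 0" .
  moreover have I: "L2_inner ?X (\<lambda>x. of_real (\<zeta> x) * g x) g = of_real (LINT x|?M. \<zeta> x * (norm (g x))\<^sup>2)" for g
    unfolding L2_inner_def integral_complex_of_real[symmetric]
    by (intro Bochner_Integration.integral_cong) (simp_all add: complex_norm_square mult.assoc del: of_real_power)
  ultimately have "(LINT x|?M. \<zeta> x * (norm (?d x))\<^sup>2) + (LINT x|?M. \<zeta> x * (norm (f' x))\<^sup>2) = 0"
    by (simp only: I of_real_add[symmetric] of_real_eq_0_iff)
  moreover have nn: "AE x in ?M. 0 \<le> \<zeta> x * (norm (g x))\<^sup>2" for g :: "real \<Rightarrow> complex"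
    using m(2) by eventually_elim (use m(1) in auto)
  then have "0 \<le> (LINT x|?M. \<zeta> x * (norm (?d x))\<^sup>2)" "0 \<le> (LINT x|?M. \<zeta> x * (norm (f' x))\<^sup>2)"
    by (intro integral_nonneg_AE; simp)+
  ultimately have zero: "(LINT x|?M. \<zeta> x * (norm (?d x))\<^sup>2) = 0" by linarith
  have int: "integrable ?M (\<lambda>x. \<zeta> x * (norm (?d x))\<^sup>2)"
  proof (rule Bochner_Integration.integrable_bound)
    show "integrable ?M (\<lambda>x. M * (norm (?d x))\<^sup>2)" using L(3) by (auto simp: L2_def)
    have [measurable]: "?d \<in> borel_measurable ?M" using L(3) by (simp add: L2_def)
    show "(\<lambda>x. \<zeta> x * (norm (?d x))\<^sup>2) \<in> borel_measurable ?M" using \<zeta> by measurable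
    show "AE x in ?M. norm (\<zeta> x * (norm (?d x))\<^sup>2) \<le> norm (M * (norm (?d x))\<^sup>2)"
      using bd by eventually_elim (auto simp: abs_mult intro!: mult_right_mono)
  qed
  have "AE x in ?M. \<zeta> x * (norm (?d x))\<^sup>2 = 0"
    using integral_nonneg_eq_0_iff_AE[OF int nn[of ?d]] zero by simp
  with m(2) show ?thesis
    unfolding f by eventually_elim (use m(1) in auto)
qed

text \<open>The constants are eigenfunctions of \<open>A0\<close> for the eigenvalue 1, and
  \<open>sqrt (inverse 1 - 1) = 0\<close>.\<close>

lemma zero_in_Sigma_exc:
  assumes "a < b" and \<zeta>: "\<zeta> \<in> borel_measurable (lebesgue_on {a<..<b})"
    and m: "m > 0" "AE x in lebesgue_on {a<..<b}. m \<le> \<zeta> x \<and> \<zeta> x \<le> M"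
  shows "0 \<in> Sigma_exc {a<..<b} \<zeta>"
proof -
  let ?X = "{a<..<b}" let ?M = "lebesgue_on ?X"
  have "1 \<notin> L2_resolvent_set ?X (A0 ?X \<zeta>)"
  proof
    assume "1 \<in> L2_resolvent_set ?X (A0 ?X \<zeta>)"
    then obtain C where C: "\<forall>f\<in>L2 ?X. \<exists>g\<in>L2 ?X. (AE x in ?M. A0 ?X \<zeta> g x - 1 * g x = f x) \<and>
        L2_norm ?X g \<le> C * L2_norm ?X f \<and>
        (\<forall>h\<in>L2 ?X. (AE x in ?M. A0 ?X \<zeta> h x - 1 * h x = f x) \<longrightarrow> (AE x in ?M. h x = g x))"
      unfolding L2_resolvent_set_def by blast
    obtain g where g: "\<And>h. h \<in> L2 ?X \<Longrightarrow> AE x in ?M. A0 ?X \<zeta> h x - 1 * h x = 0 \<Longrightarrow>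
        AE x in ?M. h x = g x"
      using bspec[OF C const_L2[of 0]] by blast
    \<comment> \<open>For right-hand side 0, uniqueness in the resolvent condition identifies every
      constant with one \<open>g\<close>; the constants 0 and 1 then clash on a set of positive
      measure.\<close>
    have "AE x in ?M. c = g x" for c
      using A0_const[OF assms, of c] by (intro g[OF const_L2]) auto
    from this[of 0] this[of 1] have "AE x in ?M. False" by eventually_elim auto
    then have "emeasure ?M (space ?M) = 0"
      by (metis ae_filter_eq_bot_iff eventually_False)
    then show False using assms(1) by (simp add: emeasure_restrict_space)
  qed
  then show ?thesis
    unfolding Sigma_exc_def L2_spec_def by (auto intro!: bexI[of _ 1])
qed

section \<open>The boundary value problem\<close>

lemma u_right_cmult:
  "u differentiable (at x) \<Longrightarrow> u_right \<omega> (\<lambda>x. c * u x) x = c * u_right \<omega> u x"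
  by (simp add: u_right_def algebra_simps)

lemma u_left_cmult:
  "u differentiable (at x) \<Longrightarrow> u_left \<omega> (\<lambda>x. c * u x) x = c * u_left \<omega> u x"
  by (simp add: u_left_def algebra_simps)

text \<open>For \<open>c \<noteq> 0\<close> the points of differentiability, hence the filter, are
  unchanged. The operator \<open>f\<close> is a parameter so that both waves are covered.\<close>

lemma limit_along_diff_cmult:
  assumes l: "limit_along_diff X u (f u) l p" and c: "c \<noteq> 0"
    and f: "\<And>x. u differentiable (at x) \<Longrightarrow> f (\<lambda>x. c * u x) x = c * f u x"
  shows "limit_along_diff X (\<lambda>x. c * u x) (f (\<lambda>x. c * u x)) (c * l) p"
proof -
  have D: "{x \<in> X. (\<lambda>x. c * u x) differentiable (at x)} = {x \<in> X. u differentiable (at x)}"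
    using c by simp
  have "((\<lambda>x. c * f u x) \<longlongrightarrow> c * l) (at p within {x \<in> X. u differentiable (at x)})"
    using l unfolding limit_along_diff_def by (intro tendsto_intros)
  then show ?thesis
    unfolding limit_along_diff_def D
    by (rule Lim_transform_within[OF _ zero_less_one]) (use f in auto)
qed

theorem theorem1:
  fixes x0 x1 \<omega> :: real and \<zeta> :: "real \<Rightarrow> real" and \<xi> :: complex
  assumes "x0 < x1"
    and "\<zeta> \<in> Reg_plus {x0<..<x1}"
    and "\<omega> \<notin> Sigma_exc {x0<..<x1} \<zeta>"
    and "\<xi> \<in> ball 0 1"
  shows "\<exists>u. bvp_solution x0 x1 \<zeta> \<omega> \<xi> u \<and>
           (\<forall>v. bvp_solution x0 x1 \<zeta> \<omega> \<xi> v \<longrightarrow> (\<forall>x\<in>{x0<..<x1}. v x = u x))"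
proof -
  let ?X = "{x0<..<x1}"
  obtain m M where m: "m > 0" "AE x in lebesgue_on ?X. m \<le> \<zeta> x \<and> \<zeta> x \<le> M"
    and meas: "\<zeta> \<in> borel_measurable (lebesgue_on ?X)"
    by (rule Reg_plus_bounds[OF assms(2)])
  have \<omega>: "\<omega> \<noteq> 0" using zero_in_Sigma_exc[OF assms(1) meas m] assms(3) by auto
  have \<xi>: "norm \<xi> < 1" using assms(4) by simp
  have lim: "(f \<longlongrightarrow> c) (ess_at ?X p)"
    if "limit_along_diff ?X u f c p" "p = x0 \<or> p = x1" "solution_pair ?X \<zeta> \<omega> u w" for u w f c p
    using that(2) by (intro limit_along_diff_ess_at[OF that(1) _ solution_pair_differentiable[OF that(3)]]) auto
  have nb: "ess_at ?X x1 \<noteq> bot" using assms(1) ess_at_neq_bot[of ?X x1] by simp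
  obtain u w \<rho> where s: "solution_pair ?X \<zeta> \<omega> u w"
    and \<rho>: "limit_along_diff ?X u (u_right \<omega> u) \<rho> x0"
    and L: "limit_along_diff ?X u (u_left \<omega> u) \<xi> x1"
    and R: "limit_along_diff ?X u (u_right \<omega> u) 1 x1"
    by (rule terminal_wave_solution[OF assms(1,2) \<omega>, of \<xi> 1])
  have "\<rho> \<noteq> 0"
  proof
    assume \<rho>0: "\<rho> = 0"
    have z: "u x = 0" if "x \<in> ?X" for x
      using solution_pair_zero[OF s assms(1) \<omega> m _ _ _ \<xi> that, of 1]
        lim[OF \<rho> _ s] lim[OF L _ s] lim[OF R _ s] \<rho>0 by simp
    \<comment> \<open>If \<open>u\<close> vanishes, so does the sum of its waves almost everywhere.
      That sum tends to \<open>1 + \<xi>\<close> at \<open>x1\<close>, which would force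
      \<open>\<xi> = - 1\<close>.\<close>
    have "AE x in lebesgue_on ?X. u x = 0" by (rule AE_I2) (use z in auto)
    with solution_pair_waves[OF s \<omega>] have "AE x in lebesgue_on ?X. u_right \<omega> u x + u_left \<omega> u x = 0"
      by eventually_elim auto
    then have "((\<lambda>x. u_right \<omega> u x + u_left \<omega> u x) \<longlongrightarrow> 0) (ess_at ?X x1)"
      by (intro tendsto_eventually ess_at_AE)
    moreover have "((\<lambda>x. u_right \<omega> u x + u_left \<omega> u x) \<longlongrightarrow> 1 + \<xi>) (ess_at ?X x1)"
      using lim[OF L _ s] lim[OF R _ s] by (intro tendsto_add) auto
    ultimately have "1 + \<xi> = 0" using nb tendsto_unique by blast
    then have "\<xi> = - 1" by (simp add: eq_neg_iff_add_eq_0 add.commute)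
    then show False using \<xi> by simp
  qed
  define c where "c = inverse \<rho>"
  have c: "c \<noteq> 0" "c * \<rho> = 1" using \<open>\<rho> \<noteq> 0\<close> by (auto simp: c_def)
  have cs: "solution_pair ?X \<zeta> \<omega> (\<lambda>x. c * u x) (\<lambda>x. c * w x)"
    by (rule solution_pair_cmult[OF s])
  note cl = limit_along_diff_cmult[where f = "u_right \<omega>", OF _ c(1) u_right_cmult]
    limit_along_diff_cmult[where f = "u_left \<omega>", OF _ c(1) u_left_cmult]
  \<comment> \<open>Scaling brings the amplitude at \<open>x0\<close> to 1 and preserves the
    condition at \<open>x1\<close>, which is homogeneous: the waves there become \<open>c\<close>
    and \<open>\<xi> * c\<close>.\<close>
  have cu: "bvp_solution x0 x1 \<zeta> \<omega> \<xi> (\<lambda>x. c * u x)"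
    unfolding bvp_solution_def ode_solution_iff
    using cs cl(1)[OF \<rho>] cl(1)[OF R] cl(2)[OF L] unfolding c(2)
    by (metis mult.right_neutral mult.commute)
  have unique: "v x = v' x"
    if v: "bvp_solution x0 x1 \<zeta> \<omega> \<xi> v" and v': "bvp_solution x0 x1 \<zeta> \<omega> \<xi> v'" and x: "x \<in> ?X" for v v' x
  proof -
    obtain w w' r r' where p: "solution_pair ?X \<zeta> \<omega> v w" "solution_pair ?X \<zeta> \<omega> v' w'"
      and b: "limit_along_diff ?X v (u_right \<omega> v) 1 x0" "limit_along_diff ?X v' (u_right \<omega> v') 1 x0"
      "limit_along_diff ?X v (u_left \<omega> v) (\<xi> * r) x1" "limit_along_diff ?X v' (u_left \<omega> v') (\<xi> * r') x1"
      "limit_along_diff ?X v (u_right \<omega> v) r x1" "limit_along_diff ?X v' (u_right \<omega> v') r' x1"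
      using v v' unfolding bvp_solution_def ode_solution_iff by blast
    have D: "AE x in lebesgue_on ?X. v differentiable (at x)" "AE x in lebesgue_on ?X. v' differentiable (at x)"
      using p by (auto intro: solution_pair_differentiable)
    let ?d = "\<lambda>x. v x - v' x"
    \<comment> \<open>The waves are additive only where both solutions are differentiable, hence
      almost everywhere, which suffices for limits along \<open>ess_at\<close>.\<close>
    have eqR: "AE x in lebesgue_on ?X. u_right \<omega> v x - u_right \<omega> v' x = u_right \<omega> ?d x"
      using D by eventually_elim (simp add: u_right_def algebra_simps)
    have eqL: "AE x in lebesgue_on ?X. u_left \<omega> v x - u_left \<omega> v' x = u_left \<omega> ?d x"
      using D by eventually_elim (simp add: u_left_def algebra_simps)
    have "(u_right \<omega> ?d \<longlongrightarrow> 1 - 1) (ess_at ?X x0)"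
      using lim[OF b(1) _ p(1)] lim[OF b(2) _ p(2)]
      by (intro Lim_transform_eventually[OF _ ess_at_AE[OF eqR]] tendsto_diff) auto
    moreover have "(u_left \<omega> ?d \<longlongrightarrow> \<xi> * r - \<xi> * r') (ess_at ?X x1)"
      using lim[OF b(3) _ p(1)] lim[OF b(4) _ p(2)]
      by (intro Lim_transform_eventually[OF _ ess_at_AE[OF eqL]] tendsto_diff) auto
    moreover have "(u_right \<omega> ?d \<longlongrightarrow> r - r') (ess_at ?X x1)"
      using lim[OF b(5) _ p(1)] lim[OF b(6) _ p(2)]
      by (intro Lim_transform_eventually[OF _ ess_at_AE[OF eqR]] tendsto_diff) auto
    ultimately have "?d x = 0"
      using solution_pair_zero[OF solution_pair_diff[OF p] assms(1) \<omega> m _ _ _ \<xi> x, of "r - r'"]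
      by (simp add: right_diff_distrib)
    then show ?thesis by simp
  qed
  show ?thesis using cu unique by blast
qed

end
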